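(* Let $(C,F,c,f)$ be an instance of the Squared Metric Facility Location Problem and let $\gamma \ge 1$. Algorithm $CS(\gamma)$ produces a random integral solution $(x,y)$ (with $y_i=1$ iff facility $i$ is opened) such that, for every facility $i$ and city $j$, \[ E[y_i f_i] = \gamma \cdot F^*_i, \qquad E\left[\min_{i\in F,\, y_i=1} c_{ij} \right] \leq \max\left\{1 + 8e^{-\gamma}, \frac{5 e^{-\gamma}+e^{-1}}{1 - \frac{1}{\gamma}}\right\} \cdot C^*_j, \] where $(x^*,y^* )$ is the optimal LP solution computed by the algorithm, $F^*_i = y^*_i f_i$ and $C^*_j = \sum_{i \in F} x^*_{ij} c_{ij}$.
   Context: Facility Location Problem: finite disjoint sets $C$ (cities), $F$ (facilities), non-negative $c_{ij}$, $f_i$; minimize $\sum_{i\in F'}f_i+\sum_{j}\min_{i\in F'}c_{ij}$ over $F'\subseteq F$. Squared metric: $\sqrt{c_{ij}}\le \sqrt{c_{ij'}}+\sqrt{c_{i'j'}}+\sqrt{c_{i'j}}$ for all $i,i'\in F$, $j,j'\in C$. Algorithm $CS(\gamma)$: (1) Compute an optimal solution $(x^*,y^* )$ of the LP $\min \sum_i y_i f_i+\sum_{j}\sum_i x_{ij}c_{ij}$ s.t. $\sum_i x_{ij}=1$ for all $j$, $x_{ij}\le y_i$, $x,y\ge 0$. (2) Set $\bar y_i=\gamma y^*_i$, and for each city $j$ define $\bar x_{ij}$ by letting $j$ be served (fractionally, with $\bar x_{ij}\le\bar y_i$, $\sum_i\bar x_{ij}=1$) entirely by its closest facilities among those with $x^*_{ij}>0$;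 by splitting facilities one may assume $\bar x_{ij}>0\Rightarrow \bar x_{ij}=\bar y_i$ and $\bar y_i\le1$. (3) $C_j=\{i:\bar x_{ij}>0\}$, $D_j=\{i:\bar x_{ij}=0, x^*_{ij}>0\}$; for $F'$ with $\sum_{i\in F'}\bar y_i>0$, $d(j,F')=\sum_{i\in F'}c_{ij}\bar y_i/\sum_{i\in F'}\bar y_i$; $d^{(c)}_j=d(j,C_j)$, $d^{(\max)}_j=\max_{i\in C_j}c_{ij}$. Clustering: repeatedly choose a remaining city $j$ minimizing $d^{(c)}_j+d^{(\max)}_j$ as cluster center with cluster $C_j$, remove $j$ and all remaining $j'$ with $C_j\cap C_{j'}\ne\emptyset$. (4) Rounding: for each cluster center $j$ open exactly one facility of $C_j$, choosing $i$ with probability $\bar x_{ij}$; open every unclustered facility independently with probability $\bar y_i$. Connect each city to its closest open facility.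
   Formalization: The connection-cost bound is stated for γ > 1 only, since at γ = 1 its denominator 1 − 1/γ is zero; and after facility splitting y_i counts the opened copies of facility i, because E[y_i f_i] = γF*_i fails for a 0/1 value y_i when γy*_i > 1. *)

theory Defs
  imports "HOL-Probability.Probability"
begin

text \<open>Instance: cities C (type 'c), facilities F (type 'f), connection costs c, opening costs f.
  Using two distinct types makes C and F disjoint.\<close>

definition squared_metric_instance ::
  "'c set \<Rightarrow> 'f set \<Rightarrow> ('f \<Rightarrow> 'c \<Rightarrow> real) \<Rightarrow> ('f \<Rightarrow> real) \<Rightarrow> bool" where
  "squared_metric_instance C F c f \<longleftrightarrow>
     finite C \<and> finite F \<and>
     (\<forall>i\<in>F. \<forall>j\<in>C. 0 \<le> c i j) \<and> (\<forall>i\<in>F. 0 \<le> f i) \<and>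
     (\<forall>i\<in>F. \<forall>i'\<in>F. \<forall>j\<in>C. \<forall>j'\<in>C.
        sqrt (c i j) \<le> sqrt (c i j') + sqrt (c i' j') + sqrt (c i' j))"

definition lp_feasible ::
  "'c set \<Rightarrow> 'f set \<Rightarrow> ('f \<Rightarrow> 'c \<Rightarrow> real) \<Rightarrow> ('f \<Rightarrow> real) \<Rightarrow> bool" where
  "lp_feasible C F x y \<longleftrightarrow>
     (\<forall>j\<in>C. (\<Sum>i\<in>F. x i j) = 1) \<and>
     (\<forall>i\<in>F. \<forall>j\<in>C. x i j \<le> y i) \<and>
     (\<forall>i\<in>F. \<forall>j\<in>C. 0 \<le> x i j) \<and> (\<forall>i\<in>F. 0 \<le> y i)"

definition lp_objective ::
  "'c set \<Rightarrow> 'f set \<Rightarrow> ('f \<Rightarrow> 'c \<Rightarrow> real) \<Rightarrow> ('f \<Rightarrow> real) \<Rightarrow>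
   ('f \<Rightarrow> 'c \<Rightarrow> real) \<Rightarrow> ('f \<Rightarrow> real) \<Rightarrow> real" where
  "lp_objective C F c f x y = (\<Sum>i\<in>F. y i * f i) + (\<Sum>j\<in>C. \<Sum>i\<in>F. x i j * c i j)"

definition lp_optimal ::
  "'c set \<Rightarrow> 'f set \<Rightarrow> ('f \<Rightarrow> 'c \<Rightarrow> real) \<Rightarrow> ('f \<Rightarrow> real) \<Rightarrow>
   ('f \<Rightarrow> 'c \<Rightarrow> real) \<Rightarrow> ('f \<Rightarrow> real) \<Rightarrow> bool" where
  "lp_optimal C F c f x y \<longleftrightarrow> lp_feasible C F x y \<and>
     (\<forall>x' y'. lp_feasible C F x' y' \<longrightarrow> lp_objective C F c f x y \<le> lp_objective C F c f x' y')"

text \<open>Step (2) after splitting facilities.  The facilities of the split instance are the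
  elements of S (of type 's); copy s is a copy of the original facility orig s \<in> F.
  ybar s is the (scaled) opening value of copy s, xbar s j the (scaled) assignment.
  The copies of facility i carry total opening value gamma * y* i; each copy has
  0 < ybar s \<le> 1; xbar s j \<in> {0, ybar s}; every city is served with total amount 1,
  only by copies of facilities with x* i j > 0, and by the closest ones among those.\<close>

definition cs_scaled_split ::
  "'c set \<Rightarrow> 'f set \<Rightarrow> ('f \<Rightarrow> 'c \<Rightarrow> real) \<Rightarrow> real \<Rightarrow>
   ('f \<Rightarrow> 'c \<Rightarrow> real) \<Rightarrow> ('f \<Rightarrow> real) \<Rightarrow>
   's set \<Rightarrow> ('s \<Rightarrow> 'f) \<Rightarrow> ('s \<Rightarrow> real) \<Rightarrow> ('s \<Rightarrow> 'c \<Rightarrow> real) \<Rightarrow> bool" where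
  "cs_scaled_split C F c \<gamma> xs ys S orig ybar xbar \<longleftrightarrow>
     finite S \<and> orig ` S \<subseteq> F \<and>
     (\<forall>s\<in>S. 0 < ybar s \<and> ybar s \<le> 1) \<and>
     (\<forall>i\<in>F. (\<Sum>s\<in>{s\<in>S. orig s = i}. ybar s) = \<gamma> * ys i) \<and>
     (\<forall>s\<in>S. \<forall>j\<in>C. xbar s j = 0 \<or> xbar s j = ybar s) \<and>
     (\<forall>s\<in>S. \<forall>j\<in>C. 0 < xbar s j \<longrightarrow> 0 < xs (orig s) j) \<and>
     (\<forall>j\<in>C. (\<Sum>s\<in>S. xbar s j) = 1) \<and>
     (\<forall>j\<in>C. \<forall>s\<in>S. \<forall>s'\<in>S. 0 < xbar s j \<and> 0 < xs (orig s') j \<and> xbar s' j = 0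
        \<longrightarrow> c (orig s) j \<le> c (orig s') j)"

definition Cset :: "'s set \<Rightarrow> ('s \<Rightarrow> 'c \<Rightarrow> real) \<Rightarrow> 'c \<Rightarrow> 's set" where
  "Cset S xbar j = {s\<in>S. 0 < xbar s j}"

definition Dset :: "'s set \<Rightarrow> ('s \<Rightarrow> 'f) \<Rightarrow> ('f \<Rightarrow> 'c \<Rightarrow> real) \<Rightarrow> ('s \<Rightarrow> 'c \<Rightarrow> real) \<Rightarrow> 'c \<Rightarrow> 's set" where
  "Dset S orig xs xbar j = {s\<in>S. xbar s j = 0 \<and> 0 < xs (orig s) j}"

definition avg_dist :: "('f \<Rightarrow> 'c \<Rightarrow> real) \<Rightarrow> ('s \<Rightarrow> 'f) \<Rightarrow> ('s \<Rightarrow> real) \<Rightarrow> 'c \<Rightarrow> 's set \<Rightarrow> real" where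
  "avg_dist c orig ybar j F' = (\<Sum>s\<in>F'. c (orig s) j * ybar s) / (\<Sum>s\<in>F'. ybar s)"

definition d_c :: "('f \<Rightarrow> 'c \<Rightarrow> real) \<Rightarrow> 's set \<Rightarrow> ('s \<Rightarrow> 'f) \<Rightarrow> ('s \<Rightarrow> real) \<Rightarrow> ('s \<Rightarrow> 'c \<Rightarrow> real) \<Rightarrow> 'c \<Rightarrow> real" where
  "d_c c S orig ybar xbar j = avg_dist c orig ybar j (Cset S xbar j)"

definition d_max :: "('f \<Rightarrow> 'c \<Rightarrow> real) \<Rightarrow> 's set \<Rightarrow> ('s \<Rightarrow> 'f) \<Rightarrow> ('s \<Rightarrow> 'c \<Rightarrow> real) \<Rightarrow> 'c \<Rightarrow> real" where
  "d_max c S orig xbar j = Max ((\<lambda>s. c (orig s) j) ` Cset S xbar j)"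

text \<open>Greedy clustering: a list of cluster centres is a valid run of the clustering step
  starting from the set R of remaining cities (key j = d^(c)_j + d^(max)_j, Cl j = C_j);
  ties are broken arbitrarily.\<close>

inductive greedy_clustering :: "('c \<Rightarrow> real) \<Rightarrow> ('c \<Rightarrow> 's set) \<Rightarrow> 'c set \<Rightarrow> 'c list \<Rightarrow> bool"
  for key :: "'c \<Rightarrow> real" and Cl :: "'c \<Rightarrow> 's set" where
  gc_Nil: "greedy_clustering key Cl {} []"
| gc_Cons: "j \<in> R \<Longrightarrow> (\<forall>j'\<in>R. key j \<le> key j') \<Longrightarrow>
     greedy_clustering key Cl (R - {j} - {j'\<in>R. Cl j \<inter> Cl j' \<noteq> {}}) js \<Longrightarrow>
     greedy_clustering key Cl R (j # js)"

definition cluster_choice :: "'s set \<Rightarrow> ('s \<Rightarrow> 'c \<Rightarrow> real) \<Rightarrow> 'c \<Rightarrow> 's pmf" where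
  "cluster_choice S xbar j = embed_pmf (\<lambda>s. if s \<in> Cset S xbar j then xbar s j else 0)"

definition cs_rounding ::
  "'s set \<Rightarrow> ('s \<Rightarrow> real) \<Rightarrow> ('s \<Rightarrow> 'c \<Rightarrow> real) \<Rightarrow> 'c list \<Rightarrow> 's set pmf" where
  "cs_rounding S ybar xbar centres =
     do {
       ch \<leftarrow> Pi_pmf (set centres) undefined (cluster_choice S xbar);
       op \<leftarrow> Pi_pmf (S - (\<Union>j\<in>set centres. Cset S xbar j)) False (\<lambda>s. bernoulli_pmf (ybar s));
       return_pmf (ch ` set centres \<union> {s\<in>S - (\<Union>j\<in>set centres. Cset S xbar j). op s})
     }"

end

theory Submission
  imports Defs
begin

text \<open>
  Fix a city \<open>j\<close>, let \<open>k\<close> be a centre whose cluster meets \<open>C\<^sub>j\<close> and whose key is at most that of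
  \<open>j\<close>, and let \<open>d\<close>, \<open>m\<close> and \<open>D\<close> be the average cost over \<open>C\<^sub>j\<close>, the maximal cost over \<open>C\<^sub>j\<close> and the
  average cost over \<open>D\<^sub>j\<close>. City \<open>j\<close> is sent to its closest open facility in \<open>C\<^sub>j \<union> D\<^sub>j\<close> of cost at
  most \<open>L = 3 (d + 2 m + (\<gamma> - 1) (D - m))\<close>, and to the open facility of the cluster of \<open>k\<close> if there
  is none.

  The probability that no facility of \<open>C\<^sub>j \<union> D\<^sub>j\<close> of cost at most \<open>t\<close> is open is at most
  \<open>exp (- W t)\<close> with \<open>W t\<close> their total weight. Bounding \<open>exp\<close> by its chords over \<open>[0, 1]\<close> and
  \<open>[1, \<gamma>]\<close>, where the weights of \<open>C\<^sub>j\<close> and \<open>D\<^sub>j\<close> live, makes the bound linear in the weights, and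
  integrating over \<open>t\<close> yields
  \<open>(1 - exp (-1)) d + (exp (-1) - exp (-\<gamma>)) D + exp (-\<gamma>) L\<close>.
  This requires the conditional expectation of the fallback cost to be at most \<open>L\<close>. By the squared
  triangle inequality it is at most three times the sum of a detour cost and the cost to \<open>k\<close>;
  conditioning can only raise the latter if facilities of \<open>D\<^sub>j\<close> close to \<open>k\<close> are excluded, and these
  either provide a cheap detour or are expensive for \<open>j\<close>, which is paid for by \<open>(\<gamma> - 1) (D - m)\<close>.
  That term is harmless: for \<open>\<gamma> \<le> 3\<close> we have \<open>L \<le> 3 d + 6 D\<close>, and for \<open>\<gamma> > 3\<close> the bound has slack.
\<close>

section \<open>Greedy clustering\<close>

lemma greedy_clustering_subset:
  assumes "greedy_clustering key Cl R js"
  shows "set js \<subseteq> R"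
  using assms by (induction rule: greedy_clustering.induct) auto

lemma greedy_clustering_disjoint:
  assumes "greedy_clustering key Cl R js" "k \<in> set js" "k' \<in> set js" "k \<noteq> k'"
  shows "Cl k \<inter> Cl k' = {}"
  using assms
proof (induction rule: greedy_clustering.induct)
  case (gc_Cons j R js)
  then show ?case
    using greedy_clustering_subset[OF gc_Cons.hyps(3)] by auto
qed simp

text \<open>Each city leaves the remaining set through some centre \<open>k\<close>, as
  \<open>k\<close> itself or because the clusters meet. At that moment it still competes for the
  minimum, whence \<open>key k \<le> key j\<close>. Nonemptiness of \<open>Cl j\<close> serves the
  case \<open>k = j\<close>.\<close>

lemma greedy_clustering_covers:
  assumes "greedy_clustering key Cl R js" "j \<in> R" "Cl j \<noteq> {}"
  obtains k where "k \<in> set js" "key k \<le> key j" "Cl k \<inter> Cl j \<noteq> {}"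
proof -
  from assms have "\<exists>k\<in>set js. key k \<le> key j \<and> Cl k \<inter> Cl j \<noteq> {}"
  proof (induction rule: greedy_clustering.induct)
    case (gc_Cons k R js)
    show ?case
    proof (cases "j = k \<or> Cl k \<inter> Cl j \<noteq> {}")
      case True
      then show ?thesis using gc_Cons by auto
    next
      case False
      then show ?thesis using gc_Cons by auto
    qed
  qed simp
  with that show thesis by blast
qed

section \<open>The rounding distribution\<close>

locale cluster_rounding =
  fixes S :: "'s set" and ybar :: "'s \<Rightarrow> real" and xbar :: "'s \<Rightarrow> 'c \<Rightarrow> real"
    and centres :: "'c list"
  assumes finite_S: "finite S"
    and ybar_nonneg: "s \<in> S \<Longrightarrow> 0 \<le> ybar s"
    and ybar_le_1: "s \<in> S \<Longrightarrow> ybar s \<le> 1"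
    and xbar_cases: "k \<in> set centres \<Longrightarrow> s \<in> S \<Longrightarrow> xbar s k = 0 \<or> xbar s k = ybar s"
    and xbar_sum: "k \<in> set centres \<Longrightarrow> (\<Sum>s\<in>S. xbar s k) = 1"
    and Cset_disjoint: "k \<in> set centres \<Longrightarrow> k' \<in> set centres \<Longrightarrow> k \<noteq> k' \<Longrightarrow>
           Cset S xbar k \<inter> Cset S xbar k' = {}"
begin

abbreviation "U \<equiv> S - (\<Union>k\<in>set centres. Cset S xbar k)"

lemma finite_Cset: "finite (Cset S xbar k)"
  using finite_S by (simp add: Cset_def)

lemma sum_ybar_Cset:
  assumes "k \<in> set centres"
  shows "(\<Sum>s\<in>Cset S xbar k. ybar s) = 1"
proof -
  have "(\<Sum>s\<in>Cset S xbar k. ybar s) = (\<Sum>s\<in>S. xbar s k)"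
    using xbar_cases[OF assms] ybar_nonneg
    by (intro sum.mono_neutral_cong_left finite_S) (force simp: Cset_def)+
  then show ?thesis using xbar_sum[OF assms] by simp
qed

lemma pmf_cluster_choice:
  assumes "k \<in> set centres"
  shows "pmf (cluster_choice S xbar k) s = (if s \<in> Cset S xbar k then ybar s else 0)"
proof -
  have "(\<integral>\<^sup>+s. ennreal (if s \<in> Cset S xbar k then xbar s k else 0) \<partial>count_space UNIV)
      = (\<Sum>s\<in>Cset S xbar k. ennreal (xbar s k))"
    by (subst nn_integral_count_space'[OF finite_Cset[of k]]) auto
  also have "\<dots> = ennreal (\<Sum>s\<in>Cset S xbar k. xbar s k)"
    by (rule sum_ennreal) (simp add: Cset_def)
  also have "(\<Sum>s\<in>Cset S xbar k. xbar s k) = (\<Sum>s\<in>Cset S xbar k. ybar s)"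
    using xbar_cases[OF assms] by (intro sum.cong) (force simp: Cset_def)+
  finally have "(\<integral>\<^sup>+s. ennreal (if s \<in> Cset S xbar k then xbar s k else 0) \<partial>count_space UNIV) = 1"
    using sum_ybar_Cset[OF assms] by simp
  then have "pmf (cluster_choice S xbar k) s = (if s \<in> Cset S xbar k then xbar s k else 0)"
    unfolding cluster_choice_def by (intro pmf_embed_pmf) (auto simp: Cset_def)
  then show ?thesis
    using xbar_cases[OF assms, of s] by (auto simp: Cset_def)
qed

lemma set_pmf_cluster_choice:
  assumes "k \<in> set centres"
  shows "set_pmf (cluster_choice S xbar k) \<subseteq> Cset S xbar k"
  using pmf_cluster_choice[OF assms] by (auto simp: set_pmf_eq split: if_splits)

lemma expectation_cluster_choice:
  fixes G :: "'s \<Rightarrow> real"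
  assumes "k \<in> set centres"
  shows "measure_pmf.expectation (cluster_choice S xbar k) G = (\<Sum>s\<in>Cset S xbar k. ybar s * G s)"
  using set_pmf_cluster_choice[OF assms] pmf_cluster_choice[OF assms]
  by (subst integral_measure_pmf_real[OF finite_Cset[of k]]) (auto simp: mult.commute)

lemma finite_U: "finite U"
  using finite_S by simp

abbreviation "choices \<equiv> Pi_pmf (set centres) undefined (cluster_choice S xbar)"
abbreviation "flips \<equiv> Pi_pmf U False (\<lambda>s. bernoulli_pmf (ybar s))"

lemma finite_set_choices: "finite (set_pmf choices)"
  using finite_subset[OF set_pmf_cluster_choice finite_Cset]
  by (subst set_Pi_pmf) (auto intro!: finite_PiE_dflt)

lemma finite_set_flips: "finite (set_pmf flips)"
  using finite_U by (subst set_Pi_pmf) (auto intro!: finite_PiE_dflt)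

lemma choices_in_Cset:
  assumes "ch \<in> set_pmf choices" "k \<in> set centres"
  shows "ch k \<in> Cset S xbar k"
  using assms set_pmf_cluster_choice[OF assms(2)] by (auto simp: set_Pi_pmf PiE_dflt_def)

lemma cs_rounding_alt:
  "cs_rounding S ybar xbar centres =
     choices \<bind> (\<lambda>ch. map_pmf (\<lambda>op. ch ` set centres \<union> {s\<in>U. op s}) flips)"
  by (simp add: cs_rounding_def map_pmf_def)

lemma finite_set_cs_rounding: "finite (set_pmf (cs_rounding S ybar xbar centres))"
  using finite_set_choices finite_set_flips by (simp add: cs_rounding_alt)

lemma set_cs_rounding_cases:
  assumes "Op \<in> set_pmf (cs_rounding S ybar xbar centres)"
  obtains ch B where "Op = ch ` set centres \<union> B" "B \<subseteq> U"
    "\<And>k. k \<in> set centres \<Longrightarrow> ch k \<in> Cset S xbar k"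
proof -
  from assms obtain ch op where "ch \<in> set_pmf choices"
    "Op = ch ` set centres \<union> {s\<in>U. op s}"
    by (auto simp: cs_rounding_alt)
  with choices_in_Cset that[of ch "{s\<in>U. op s}"] show thesis by blast
qed

lemma cs_rounding_subset:
  assumes "Op \<in> set_pmf (cs_rounding S ybar xbar centres)"
  shows "Op \<subseteq> S"
  using assms by (rule set_cs_rounding_cases) (auto simp: Cset_def)

lemma cs_rounding_Int_Cset:
  assumes "Op \<in> set_pmf (cs_rounding S ybar xbar centres)" "k \<in> set centres"
  obtains s where "Op \<inter> Cset S xbar k = {s}"
proof -
  from assms(1) obtain ch B where *: "Op = ch ` set centres \<union> B" "B \<subseteq> U"
    "\<And>k. k \<in> set centres \<Longrightarrow> ch k \<in> Cset S xbar k"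
    using set_cs_rounding_cases by metis
  have "ch k' \<notin> Cset S xbar k" if "k' \<in> set centres" "k' \<noteq> k" for k'
    using *(3)[OF that(1)] Cset_disjoint[OF that(1) assms(2) that(2)] by blast
  then have "Op \<inter> Cset S xbar k = {ch k}"
    using *(1,2) *(3)[OF assms(2)] assms(2) by auto
  with that show thesis .
qed

text \<open>Independent choices in disjoint clusters and independent coins outside make the product
  factorize. Later probabilities come from it through the choice of \<open>F\<close>: a 0-1 function
  gives opening probabilities, \<open>1 - \<theta>\<close> survival probabilities, and a cost placed
  on one cluster a connection cost.\<close>

lemma expectation_prod_cs_rounding:
  assumes F: "\<And>s. s \<in> S \<Longrightarrow> 0 \<le> F s"
  shows "measure_pmf.expectation (cs_rounding S ybar xbar centres) (\<lambda>Op. \<Prod>s\<in>Op. F s) =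
    (\<Prod>k\<in>set centres. \<Sum>s\<in>Cset S xbar k. ybar s * F s) * (\<Prod>s\<in>U. ybar s * F s + (1 - ybar s))"
proof -
  have prod_eq: "(\<Prod>s\<in>ch ` set centres \<union> {s\<in>U. op s}. F s)
      = (\<Prod>k\<in>set centres. F (ch k)) * (\<Prod>s\<in>U. if op s then F s else 1)"
    if ch: "ch \<in> set_pmf choices" for ch op
  proof -
    have inj: "inj_on ch (set centres)"
      using choices_in_Cset[OF ch] Cset_disjoint by (fastforce simp: inj_on_def)
    have "ch ` set centres \<inter> {s\<in>U. op s} = {}"
      using choices_in_Cset[OF ch] by auto
    then have "(\<Prod>s\<in>ch ` set centres \<union> {s\<in>U. op s}. F s)
        = (\<Prod>s\<in>ch ` set centres. F s) * (\<Prod>s\<in>{s\<in>U. op s}. F s)"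
      using finite_S by (intro prod.union_disjoint) auto
    also have "(\<Prod>s\<in>{s\<in>U. op s}. F s) = (\<Prod>s\<in>U. if op s then F s else 1)"
      by (rule prod.inter_filter[OF finite_U])
    also have "(\<Prod>s\<in>ch ` set centres. F s) = (\<Prod>k\<in>set centres. F (ch k))"
      using inj by (simp add: prod.reindex)
    finally show ?thesis .
  qed
  have F_Cset: "0 \<le> F s" if "s \<in> set_pmf (cluster_choice S xbar k)" "k \<in> set centres" for s k
    using set_pmf_cluster_choice[OF that(2)] that(1) F by (auto simp: Cset_def)
  have "measure_pmf.expectation (cs_rounding S ybar xbar centres) (\<lambda>Op. \<Prod>s\<in>Op. F s)
     = (\<Sum>ch\<in>set_pmf choices. pmf choices ch *
          measure_pmf.expectation flips (\<lambda>op. \<Prod>s\<in>ch ` set centres \<union> {s\<in>U. op s}. F s))"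
    using finite_set_choices finite_set_flips
    by (simp add: cs_rounding_alt pmf_expectation_bind[where A = "set_pmf choices"])
  also have "\<dots> = (\<Sum>ch\<in>set_pmf choices. pmf choices ch *
          ((\<Prod>k\<in>set centres. F (ch k)) *
            measure_pmf.expectation flips (\<lambda>op. \<Prod>s\<in>U. if op s then F s else 1)))"
    by (intro sum.cong refl) (simp add: prod_eq del: Diff_iff)
  also have "\<dots> = measure_pmf.expectation choices (\<lambda>ch. \<Prod>k\<in>set centres. F (ch k)) *
            measure_pmf.expectation flips (\<lambda>op. \<Prod>s\<in>U. if op s then F s else 1)"
    by (subst integral_measure_pmf_real[OF finite_set_choices])
       (auto simp: sum_distrib_right mult_ac)
  also have "measure_pmf.expectation choices (\<lambda>ch. \<Prod>k\<in>set centres. F (ch k))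
      = (\<Prod>k\<in>set centres. measure_pmf.expectation (cluster_choice S xbar k) F)"
    using finite_subset[OF set_pmf_cluster_choice finite_Cset] F_Cset
    by (intro expectation_prod_Pi_pmf integrable_measure_pmf_finite) auto
  also have "\<dots> = (\<Prod>k\<in>set centres. \<Sum>s\<in>Cset S xbar k. ybar s * F s)"
    by (intro prod.cong refl expectation_cluster_choice)
  also have "measure_pmf.expectation flips (\<lambda>op. \<Prod>s\<in>U. if op s then F s else 1)
      = (\<Prod>s\<in>U. measure_pmf.expectation (bernoulli_pmf (ybar s)) (\<lambda>b. if b then F s else 1))"
    using F by (intro expectation_prod_Pi_pmf[OF finite_U] integrable_measure_pmf_finite) auto
  also have "\<dots> = (\<Prod>s\<in>U. ybar s * F s + (1 - ybar s))"
    using ybar_nonneg ybar_le_1 by (intro prod.cong refl) auto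
  finally show ?thesis .
qed

text \<open>With \<open>?F\<close> vanishing only at \<open>s\<close>, the product indicates that
  \<open>s\<close> stays closed. Exactly one factor involves \<open>s\<close>, that of its cluster
  or of its own coin, and it equals \<open>1 - ybar s\<close>.\<close>

lemma prob_open_cs_rounding:
  assumes "s \<in> S"
  shows "measure_pmf.prob (cs_rounding S ybar xbar centres) {Op. s \<in> Op} = ybar s"
proof -
  let ?F = "\<lambda>t. if t = s then 0 else 1 :: real"
  have ind: "(\<Prod>t\<in>Op. ?F t) = indicator {Op. s \<notin> Op} Op"
    if "Op \<in> set_pmf (cs_rounding S ybar xbar centres)" for Op
    using finite_subset[OF cs_rounding_subset[OF that] finite_S] by (auto simp: prod_zero_iff)
  have sum_F: "(\<Sum>t\<in>Cset S xbar k. ybar t * ?F t) = (if s \<in> Cset S xbar k then 1 - ybar s else 1)"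
    if "k \<in> set centres" for k
  proof -
    have "(\<Sum>t\<in>Cset S xbar k. ybar t * ?F t)
        = (\<Sum>t\<in>Cset S xbar k. ybar t - (if t = s then ybar s else 0))"
      by (intro sum.cong) auto
    then show ?thesis using sum_ybar_Cset[OF that] finite_Cset[of k] by (simp add: sum_subtractf)
  qed
  have "1 - measure_pmf.prob (cs_rounding S ybar xbar centres) {Op. s \<in> Op}
     = measure_pmf.prob (cs_rounding S ybar xbar centres) {Op. s \<notin> Op}"
    by (subst measure_pmf.prob_compl[symmetric]) (auto intro!: arg_cong2[where f = measure])
  also have "\<dots> = measure_pmf.expectation (cs_rounding S ybar xbar centres) (\<lambda>Op. \<Prod>t\<in>Op. ?F t)"
    using ind by (subst integral_cong_AE[where g = "indicator {Op. s \<notin> Op}"])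
      (auto simp: AE_measure_pmf_iff)
  also have "\<dots> = (\<Prod>k\<in>set centres. if s \<in> Cset S xbar k then 1 - ybar s else 1)
      * (\<Prod>t\<in>U. if t = s then 1 - ybar s else 1)"
    by (subst expectation_prod_cs_rounding)
       (auto simp: sum_F intro!: arg_cong2[where f = "(*)"] prod.cong)
  also have "\<dots> = 1 - ybar s"
  proof (cases "s \<in> U")
    case True
    then have "(\<Prod>k\<in>set centres. if s \<in> Cset S xbar k then 1 - ybar s else 1) = 1"
      by (intro prod.neutral) auto
    with True show ?thesis using finite_U by (simp add: prod.delta)
  next
    case False
    then obtain k where k: "k \<in> set centres" "s \<in> Cset S xbar k"
      using assms by auto
    have "(\<Prod>k\<in>set centres. if s \<in> Cset S xbar k then 1 - ybar s else 1)
        = (\<Prod>k'\<in>set centres. if k' = k then 1 - ybar s else 1)"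
      using k Cset_disjoint by (intro prod.cong) auto
    moreover have "(\<Prod>t\<in>U. if t = s then 1 - ybar s else 1) = 1"
      using False by (intro prod.neutral) auto
    ultimately show ?thesis using k by (simp add: prod.delta)
  qed
  finally show ?thesis by simp
qed

text \<open>Read \<open>\<theta> s\<close> as the probability that \<open>s\<close>, if open,
  counts; the left side is then the probability that nothing counts. Cluster factors and coin
  factors all have the form \<open>1 - x \<le> exp (- x)\<close>, and the exponents add up over the
  partition of \<open>S\<close> into clusters and \<open>U\<close>.\<close>

lemma expectation_prod_compl_le_exp:
  assumes \<theta>: "\<And>s. s \<in> S \<Longrightarrow> 0 \<le> \<theta> s" "\<And>s. s \<in> S \<Longrightarrow> \<theta> s \<le> 1"
  shows "measure_pmf.expectation (cs_rounding S ybar xbar centres) (\<lambda>Op. \<Prod>s\<in>Op. 1 - \<theta> s)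
     \<le> exp (- (\<Sum>s\<in>S. ybar s * \<theta> s))"
proof -
  have K: "(\<Sum>s\<in>Cset S xbar k. ybar s * (1 - \<theta> s)) = 1 - (\<Sum>s\<in>Cset S xbar k. ybar s * \<theta> s)"
    if "k \<in> set centres" for k
    using sum_ybar_Cset[OF that] by (simp add: algebra_simps sum_subtractf)
  have K0: "0 \<le> (\<Sum>s\<in>Cset S xbar k. ybar s * (1 - \<theta> s))" for k
    using ybar_nonneg \<theta> by (intro sum_nonneg mult_nonneg_nonneg) (auto simp: Cset_def)
  have U0: "0 \<le> ybar s * (1 - \<theta> s) + (1 - ybar s)" if "s \<in> U" for s
    using that ybar_nonneg[of s] ybar_le_1[of s] \<theta>[of s] by simp
  have "measure_pmf.expectation (cs_rounding S ybar xbar centres) (\<lambda>Op. \<Prod>s\<in>Op. 1 - \<theta> s)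
      = (\<Prod>k\<in>set centres. \<Sum>s\<in>Cset S xbar k. ybar s * (1 - \<theta> s))
        * (\<Prod>s\<in>U. ybar s * (1 - \<theta> s) + (1 - ybar s))"
    using \<theta> by (intro expectation_prod_cs_rounding) auto
  also have "\<dots> \<le> (\<Prod>k\<in>set centres. exp (- (\<Sum>s\<in>Cset S xbar k. ybar s * \<theta> s)))
        * (\<Prod>s\<in>U. exp (- (ybar s * \<theta> s)))"
  proof (intro mult_mono prod_mono conjI K0 U0 prod_nonneg ballI)
    fix k assume k: "k \<in> set centres"
    show "(\<Sum>s\<in>Cset S xbar k. ybar s * (1 - \<theta> s)) \<le> exp (- (\<Sum>s\<in>Cset S xbar k. ybar s * \<theta> s))"
      using exp_ge_add_one_self[of "- (\<Sum>s\<in>Cset S xbar k. ybar s * \<theta> s)"] by (simp add: K[OF k])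
  next
    fix s
    show "ybar s * (1 - \<theta> s) + (1 - ybar s) \<le> exp (- (ybar s * \<theta> s))"
      using exp_ge_add_one_self[of "- (ybar s * \<theta> s)"] by (simp add: algebra_simps)
  qed auto
  also have "\<dots> = exp (- ((\<Sum>k\<in>set centres. \<Sum>s\<in>Cset S xbar k. ybar s * \<theta> s)
        + (\<Sum>s\<in>U. ybar s * \<theta> s)))"
    using finite_U by (simp add: exp_sum[symmetric] sum_negf exp_add[symmetric])
  also have "(\<Sum>k\<in>set centres. \<Sum>s\<in>Cset S xbar k. ybar s * \<theta> s)
      = (\<Sum>s\<in>(\<Union>k\<in>set centres. Cset S xbar k). ybar s * \<theta> s)"
    using finite_Cset Cset_disjoint by (intro sum.UNION_disjoint[symmetric]) auto
  also have "\<dots> + (\<Sum>s\<in>U. ybar s * \<theta> s) = (\<Sum>s\<in>S. ybar s * \<theta> s)"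
  proof -
    have "(\<Union>k\<in>set centres. Cset S xbar k) \<subseteq> S"
      by (auto simp: Cset_def)
    from sum.subset_diff[OF this finite_S] show ?thesis
      by (metis add.commute)
  qed
  finally show ?thesis .
qed

end

section \<open>Deterministic estimates\<close>

lemma exp_le_chord:
  fixes a b x :: real
  assumes "a < b" "a \<le> x" "x \<le> b"
  shows "exp (- x) \<le> exp (- a) - (exp (- a) - exp (- b)) / (b - a) * (x - a)"
proof -
  define t where "t = (x - a) / (b - a)"
  have t: "0 \<le> t" "t \<le> 1" using assms by (auto simp: t_def)
  have "t * (b - a) = x - a" using assms by (simp add: t_def)
  then have "(1 - t) *\<^sub>R (- a) + t *\<^sub>R (- b) = - x"
    by (simp add: algebra_simps)
  then have "exp (- x) \<le> (1 - t) * exp (- a) + t * exp (- b)"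
    using convex_onD[OF exp_convex, of t "- a" "- b"] t by simp
  also have "\<dots> = exp (- a) - (exp (- a) - exp (- b)) / (b - a) * (x - a)"
    by (simp add: t_def algebra_simps diff_divide_distrib)
  finally show ?thesis .
qed

text \<open>Cauchy-Schwarz for three terms, from the squares of the pairwise differences. It turns
  the squared metric condition into a triangle inequality with factor 3, the source of the 3 in
  \<open>L\<close>.\<close>

lemma sq_sum3_le:
  fixes x y z w :: real
  assumes "0 \<le> x" "0 \<le> y" "0 \<le> z" "0 \<le> w" "sqrt w \<le> sqrt x + sqrt y + sqrt z"
  shows "w \<le> 3 * (x + y + z)"
proof -
  have "w = (sqrt w)\<^sup>2" using assms by simp
  also have "\<dots> \<le> (sqrt x + sqrt y + sqrt z)\<^sup>2"
    using assms by (intro power_mono) auto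
  also have "\<dots> \<le> 3 * ((sqrt x)\<^sup>2 + (sqrt y)\<^sup>2 + (sqrt z)\<^sup>2)"
    using zero_le_power2[of "sqrt x - sqrt y"] zero_le_power2[of "sqrt x - sqrt z"]
      zero_le_power2[of "sqrt y - sqrt z"]
    by (simp add: power2_eq_square algebra_simps)
  finally show ?thesis using assms by simp
qed

text \<open>
  Here \<open>a\<close> and \<open>b\<close> are the costs to the city and to its cluster centre, \<open>A\<close> consists of the shared
  close facilities, and \<open>\<theta>\<close> is the probability that a facility counts as a direct connection. The
  best detour costs at most \<open>m\<close> plus the cheapest \<open>b\<close> on \<open>A\<close>, and at most the \<open>\<theta>\<close>-weighted mean of
  \<open>a + b\<close> off \<open>A\<close>; weighting the two bounds by the respective masses gives the claim.
\<close>

lemma detour_cost_le: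
  fixes y a b \<theta> :: "'s \<Rightarrow> real" and m u \<Delta> :: real
  assumes "finite K" and y: "\<And>s. s \<in> K \<Longrightarrow> 0 \<le> y s" "(\<Sum>s\<in>K. y s) = 1"
    and \<theta>: "\<And>s. s \<in> K \<Longrightarrow> 0 \<le> \<theta> s" "\<And>s. s \<in> K \<Longrightarrow> \<theta> s \<le> 1"
    and detour: "\<And>i k. i \<in> K \<Longrightarrow> k \<in> K \<Longrightarrow> a i \<le> 3 * (a k + b k + b i)"
    and u: "\<And>s. s \<in> K \<Longrightarrow> b s \<le> u"
    and A: "A \<subseteq> K" "A \<noteq> {}" "\<And>s. s \<in> A \<Longrightarrow> \<theta> s = 1" "\<And>s. s \<in> A \<Longrightarrow> a s \<le> m"
    and \<Delta>: "(\<Sum>s\<in>K - A. y s * \<theta> s * (a s - m)) \<le> \<Delta>"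
  shows "(\<Sum>s\<in>K. y s * (1 - \<theta> s) * a s)
       \<le> 3 * (m + u + (\<Sum>s\<in>K. y s * b s) + \<Delta>) * (\<Sum>s\<in>K. y s * (1 - \<theta> s))"
proof -
  \<comment> \<open>\<open>h\<close> is the cheapest detour through the cluster and \<open>p\<close>
    the cheapest cost to the centre on \<open>A\<close>; \<open>\<rho>\<close> is the mass not
    counted as direct, \<open>\<alpha>\<close> and \<open>\<beta>\<close> the counted mass on and
    off \<open>A\<close>.\<close>
  define h where "h = Min ((\<lambda>k. a k + b k) ` K)"
  define p where "p = Min (b ` A)"
  define \<rho> where "\<rho> = (\<Sum>s\<in>K. y s * (1 - \<theta> s))"
  define \<alpha> where "\<alpha> = (\<Sum>s\<in>A. y s)"
  define \<beta> where "\<beta> = (\<Sum>s\<in>K - A. y s * \<theta> s)"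
  define R where "R = (\<Sum>s\<in>K. y s * (1 - \<theta> s) * b s)"
  define P where "P = (\<Sum>s\<in>A. y s * b s)"
  define Q where "Q = (\<Sum>s\<in>K - A. y s * \<theta> s * b s)"
  have finA: "finite A" using A(1) \<open>finite K\<close> by (rule finite_subset)
  have K0: "K \<noteq> {}" using A by auto
  have split_\<theta>: "(\<Sum>s\<in>K. y s * \<theta> s * w s) = (\<Sum>s\<in>A. y s * w s) + (\<Sum>s\<in>K - A. y s * \<theta> s * w s)"
    for w :: "'s \<Rightarrow> real"
    using sum.subset_diff[OF A(1) \<open>finite K\<close>, of "\<lambda>s. y s * \<theta> s * w s"] A(3)
    by (simp add: add.commute)
  have "(\<Sum>s\<in>K. y s) = \<rho> + (\<Sum>s\<in>K. y s * \<theta> s * 1)"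
    by (simp add: \<rho>_def algebra_simps sum_subtractf)
  then have total: "\<alpha> + \<beta> + \<rho> = 1"
    unfolding split_\<theta> y(2) by (simp add: \<alpha>_def \<beta>_def)
  have "(\<Sum>s\<in>K. y s * b s) = R + (\<Sum>s\<in>K. y s * \<theta> s * b s)"
    by (simp add: R_def algebra_simps sum_subtractf)
  then have sum_b: "(\<Sum>s\<in>K. y s * b s) = R + P + Q"
    unfolding split_\<theta> by (simp add: P_def Q_def)
  have nonneg: "0 \<le> \<rho>" "0 \<le> \<alpha>" "0 \<le> \<beta>"
    using y \<theta> A(1) by (auto simp: \<rho>_def \<alpha>_def \<beta>_def intro!: sum_nonneg mult_nonneg_nonneg)
  have hK: "h \<le> a k + b k" if "k \<in> K" for k
    unfolding h_def using that \<open>finite K\<close> by (intro Min_le) auto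
  have "p \<in> b ` A"
    unfolding p_def using finA A(2) by (intro Min_in) auto
  then obtain s\<^sub>0 where s0: "s\<^sub>0 \<in> A" "p = b s\<^sub>0" by auto
  have h_mp: "h \<le> m + p" using hK[of s\<^sub>0] s0 A by fastforce
  have pu: "p \<le> u" using s0 u A by auto
  have "\<alpha> * p \<le> P"
    unfolding \<alpha>_def P_def sum_distrib_right
    using finA A(1) y(1) by (intro sum_mono mult_left_mono) (auto simp: p_def)
  have "R \<le> \<rho> * u"
    unfolding R_def \<rho>_def sum_distrib_right
    using y \<theta> u by (intro sum_mono mult_left_mono mult_nonneg_nonneg) auto
  have "\<beta> * h \<le> (\<Sum>s\<in>K - A. y s * \<theta> s * (a s + b s))"
    unfolding \<beta>_def sum_distrib_right
    using y \<theta> hK by (intro sum_mono mult_left_mono mult_nonneg_nonneg) auto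
  also have "\<dots> = (\<Sum>s\<in>K - A. y s * \<theta> s * (a s - m)) + \<beta> * m + Q"
    unfolding \<beta>_def Q_def sum_distrib_right sum.distrib[symmetric]
    by (intro sum.cong) (auto simp: algebra_simps)
  finally have \<beta>h: "\<beta> * h \<le> \<Delta> + \<beta> * m + Q" using \<Delta> by linarith
  have "h = \<beta> * h + (\<alpha> + \<rho>) * h"
    using total by (metis add.assoc add.commute distrib_right mult_1)
  also have "\<dots> \<le> (\<Delta> + \<beta> * m + Q) + (\<alpha> + \<rho>) * (m + p)"
    using \<beta>h h_mp nonneg by (intro add_mono mult_left_mono) auto
  also have "\<dots> = (\<alpha> + \<beta> + \<rho>) * m + \<Delta> + Q + \<alpha> * p + \<rho> * p"
    by (simp add: algebra_simps)
  finally have h_le: "h \<le> m + \<Delta> + Q + P + \<rho> * p"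
    using \<open>\<alpha> * p \<le> P\<close> by (simp add: total)
  \<comment> \<open>The target contains \<open>R\<close> only with weight \<open>\<rho>\<close>; the
    rest \<open>(1 - \<rho>) * R\<close> and the term \<open>\<rho> * (\<rho> * p)\<close> are
    together paid by a single \<open>\<rho> * u\<close>.\<close>
  have "(1 - \<rho>) * R \<le> (1 - \<rho>) * (\<rho> * u)"
    using \<open>R \<le> \<rho> * u\<close> total nonneg by (intro mult_left_mono) auto
  moreover have "\<rho> * (\<rho> * p) \<le> \<rho> * (\<rho> * u)"
    using pu nonneg by (intro mult_left_mono) auto
  ultimately have "\<rho> * (\<rho> * p) + R \<le> \<rho> * (u + R)"
    by (simp add: algebra_simps)
  moreover have "\<rho> * h \<le> \<rho> * (m + \<Delta> + Q + P + \<rho> * p)"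
    using h_le nonneg by (intro mult_left_mono) auto
  ultimately have main: "\<rho> * h + R \<le> \<rho> * (m + u + (R + P + Q) + \<Delta>)"
    by (simp add: algebra_simps)
  have "a s \<le> 3 * (h + b s)" if "s \<in> K" for s
  proof -
    have "h \<in> (\<lambda>k. a k + b k) ` K"
      unfolding h_def using \<open>finite K\<close> K0 by (intro Min_in) auto
    then obtain k where "k \<in> K" "h = a k + b k" by auto
    with detour[OF that] show ?thesis by auto
  qed
  then have "(\<Sum>s\<in>K. y s * (1 - \<theta> s) * a s) \<le> (\<Sum>s\<in>K. y s * (1 - \<theta> s) * (3 * (h + b s)))"
    using y \<theta> by (intro sum_mono mult_left_mono mult_nonneg_nonneg) auto
  also have "\<dots> = 3 * (\<rho> * h + R)"
    unfolding \<rho>_def R_def sum_distrib_right sum_distrib_left sum.distrib[symmetric]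
    by (intro sum.cong) (auto simp: algebra_simps)
  finally show ?thesis
    using main unfolding sum_b \<rho>_def[symmetric] by (simp add: algebra_simps)
qed

section \<open>Layer-cake integration of threshold products\<close>

lemma has_integral_step:
  fixes a L :: real
  assumes "0 \<le> a" "0 \<le> L"
  shows "((\<lambda>t. of_bool (t < a)) has_integral min a L) {0..L}"
proof -
  have "((\<lambda>t. 1::real) has_integral min a L) {0..min a L}"
    using has_integral_const_real[of "1::real" 0 "min a L"] assms by simp
  then have "((\<lambda>t. if t \<in> {0..min a L} then 1 else 0 :: real) has_integral min a L) {0..L}"
    by (subst has_integral_restrict) auto
  then show ?thesis
    by (rule has_integral_spike_finite[where S = "{a}", rotated 2]) auto
qed

lemma prod_threshold_antimono:
  fixes \<mu> v :: "'s \<Rightarrow> real"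
  assumes "\<And>s. s \<in> A \<Longrightarrow> 0 \<le> \<mu> s" "\<And>s. s \<in> A \<Longrightarrow> \<mu> s \<le> 1" "t \<le> t'"
  shows "(\<Prod>s\<in>A. 1 - \<mu> s * of_bool (v s \<le> t')) \<le> (\<Prod>s\<in>A. 1 - \<mu> s * of_bool (v s \<le> t))"
  using assms by (intro prod_mono) (force simp: of_bool_def)

text \<open>Raising the threshold only lowers factors, so the product is antitone in
  \<open>t\<close>; monotone functions are integrable on a closed interval.\<close>

lemma integrable_prod_threshold:
  fixes \<mu> v :: "'s \<Rightarrow> real"
  assumes "\<And>s. s \<in> A \<Longrightarrow> 0 \<le> \<mu> s" "\<And>s. s \<in> A \<Longrightarrow> \<mu> s \<le> 1"
  shows "(\<lambda>t. \<Prod>s\<in>A. 1 - \<mu> s * of_bool (v s \<le> t)) integrable_on {0..L::real}"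
proof -
  have "(\<lambda>t. - (\<Prod>s\<in>A. 1 - \<mu> s * of_bool (v s \<le> t))) integrable_on {0..L}"
    using prod_threshold_antimono[OF assms]
    by (intro integrable_on_mono_on) (auto simp: monotone_on_def)
  then show ?thesis by (simp add: integrable_neg_iff)
qed

text \<open>
  Mark each element \<open>s\<close> of \<open>A\<close> independently with probability \<open>\<mu> s\<close> and go to the closest marked
  element within distance \<open>L\<close>, or to \<open>i\<close> if there is none. The right-hand side is the expected
  cost of this choice by the layer-cake formula.
\<close>

lemma Min_le_integral_prod_threshold:
  fixes \<mu> v :: "'s \<Rightarrow> real"
  assumes "finite A" "i \<in> A" "0 \<le> L" and v: "\<And>s. s \<in> A \<Longrightarrow> 0 \<le> v s"
    and \<mu>: "\<And>s. s \<in> A \<Longrightarrow> 0 \<le> \<mu> s" "\<And>s. s \<in> A \<Longrightarrow> \<mu> s \<le> 1"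
  defines "g \<equiv> \<lambda>t. \<Prod>s\<in>A. 1 - \<mu> s * of_bool (v s \<le> t)"
  shows "Min (v ` A) \<le> integral {0..L} g + (v i - L) * g L"
proof -
  define z where "z = Min (v ` A)"
  define z' where "z' = min z L"
  have z: "z \<le> v s" if "s \<in> A" for s
    using that \<open>finite A\<close> by (simp add: z_def)
  have "z \<in> v ` A" unfolding z_def using assms by (intro Min_in) auto
  then have "0 \<le> z" using v by auto
  have g1: "g t = 1" if "t < z" for t
    using that z unfolding g_def by (intro prod.neutral) force
  have g_le: "g L \<le> g t" if "t \<le> L" for t
    unfolding g_def by (rule prod_threshold_antimono[OF \<mu> that])
  have gL0: "0 \<le> g L"
    unfolding g_def using \<mu> by (intro prod_nonneg) (auto simp: of_bool_def)
  \<comment> \<open>On \<open>{0..L}\<close>, \<open>g\<close> dominates the step function that is 1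
    before the closest element and \<open>g L\<close> afterwards.\<close>
  have "((\<lambda>t. of_bool (t < z)) has_integral z') {0..L}"
    unfolding z'_def by (rule has_integral_step) fact+
  then have "((\<lambda>t. g L + (1 - g L) * of_bool (t < z)) has_integral (L * g L + (1 - g L) * z')) {0..L}"
    using has_integral_const_real[of "g L" 0 L] \<open>0 \<le> L\<close>
    by (intro has_integral_add has_integral_mult_right) auto
  moreover have "(g has_integral integral {0..L} g) {0..L}"
    unfolding g_def by (intro integrable_integral integrable_prod_threshold \<mu>)
  ultimately have "L * g L + (1 - g L) * z' \<le> integral {0..L} g"
  proof (rule has_integral_le)
    fix t assume "t \<in> {0..L}"
    then show "g L + (1 - g L) * of_bool (t < z) \<le> g t"
      using g1[of t] g_le[of t] by (auto simp: z'_def)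
  qed
  then have le: "z' + (v i - z') * g L \<le> integral {0..L} g + (v i - L) * g L"
    by (simp add: algebra_simps)
  show ?thesis
  \<comment> \<open>If \<open>z > L\<close>, nothing within \<open>L\<close> can be marked, so
    \<open>g L = 1\<close> and \<open>le\<close> bounds \<open>v i\<close> itself.\<close>
  proof (cases "z \<le> L")
    case True
    then have "0 \<le> (v i - z') * g L"
      using z[OF \<open>i \<in> A\<close>] gL0 by (intro mult_nonneg_nonneg) (auto simp: z'_def)
    with le True show ?thesis by (simp add: z'_def z_def)
  next
    case False
    with le g1[of L] z[OF \<open>i \<in> A\<close>] show ?thesis by (simp add: z_def)
  qed
qed

lemma expectation_integral_finite:
  fixes f :: "'a \<Rightarrow> real \<Rightarrow> real"
  assumes "finite (set_pmf p)" "\<And>x. x \<in> set_pmf p \<Longrightarrow> f x integrable_on T"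
  shows "((\<lambda>t. measure_pmf.expectation p (\<lambda>x. f x t)) has_integral
           measure_pmf.expectation p (\<lambda>x. integral T (f x))) T"
proof -
  have eq: "measure_pmf.expectation p h = (\<Sum>x\<in>set_pmf p. h x * pmf p x)" for h :: "'a \<Rightarrow> real"
    by (rule integral_measure_pmf_real[OF assms(1)])
  show ?thesis
    unfolding eq using assms
    by (intro has_integral_sum has_integral_mult_left integrable_integral) auto
qed

text \<open>\<open>q\<close> is weight \<open>\<gamma> - 1\<close> at average cost
  \<open>D = q / (\<gamma> - 1)\<close>, so \<open>X\<close> is at least
  \<open>d + (1 - 1 / \<gamma>) * (D - d)\<close>. It suffices to compare coefficients of the
  nonnegative numbers \<open>d\<close> and \<open>D - d\<close>; for \<open>\<gamma> \<le> 3\<close>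
  the two arguments of \<open>max\<close> are exactly what these coefficients need.\<close>

lemma approximation_ratio:
  fixes \<gamma> :: real
  assumes "1 < \<gamma>" "0 \<le> d" "d \<le> m" "(\<gamma> - 1) * m \<le> q" "d + q \<le> \<gamma> * X"
  shows "(1 - exp (- 1)) * d + (exp (- 1) - exp (- \<gamma>)) / (\<gamma> - 1) * q
           + exp (- \<gamma>) * (3 * (d + 2 * m + (q - (\<gamma> - 1) * m)))
       \<le> max (1 + 8 * exp (- \<gamma>)) ((5 * exp (- \<gamma>) + exp (- 1)) / (1 - 1 / \<gamma>)) * X"
proof -
  define \<epsilon> where "\<epsilon> = exp (- \<gamma>)"
  define e where "e = exp (- 1 :: real)"
  define D where "D = q / (\<gamma> - 1)"
  define R where "R = max (1 + 8 * \<epsilon>) ((5 * \<epsilon> + e) / (1 - 1 / \<gamma>))"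
  have \<epsilon>: "0 < \<epsilon>" by (simp add: \<epsilon>_def)
  have q: "q = (\<gamma> - 1) * D" using assms by (simp add: D_def)
  have mD: "m \<le> D" using assms by (simp add: D_def field_simps)
  have dD: "d \<le> D" using mD assms by simp
  have g: "0 < 1 - 1 / \<gamma>" using assms by (simp add: field_simps)
  have R1: "1 + 8 * \<epsilon> \<le> R" by (simp add: R_def)
  have "(5 * \<epsilon> + e) / (1 - 1 / \<gamma>) \<le> R" by (simp add: R_def)
  then have R2: "5 * \<epsilon> + e \<le> R * (1 - 1 / \<gamma>)" using g by (simp add: pos_divide_le_eq)
  have "(d + q) / \<gamma> \<le> X" using assms by (simp add: field_simps)
  moreover have "(d + q) / \<gamma> = d + (1 - 1 / \<gamma>) * (D - d)"
    using assms by (simp add: q field_simps)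
  ultimately have X: "d + (1 - 1 / \<gamma>) * (D - d) \<le> X" by simp
  \<comment> \<open>Both sides are compared as combinations of \<open>d\<close> and \<open>D - d\<close>.\<close>
  have goal: "(1 - e) * d + (e - \<epsilon>) * D + \<epsilon> * (3 * (d + 2 * m + (\<gamma> - 1) * (D - m)))
      \<le> (1 + 8 * \<epsilon>) * d + R * (1 - 1 / \<gamma>) * (D - d)"
  proof (cases "\<gamma> \<le> 3")
    case True
    have "(\<gamma> - 1) * (D - m) \<le> 2 * (D - m)"
      using True mD by (intro mult_right_mono) auto
    then have "\<epsilon> * (3 * (d + 2 * m + (\<gamma> - 1) * (D - m))) \<le> \<epsilon> * (3 * (d + 2 * D))"
      using \<epsilon> by (intro mult_left_mono) auto
    moreover have "(5 * \<epsilon> + e) * (D - d) \<le> R * (1 - 1 / \<gamma>) * (D - d)"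
      using R2 dD by (intro mult_right_mono) auto
    ultimately show ?thesis by (simp add: algebra_simps)
  next
    case False
    then have g3: "3 \<le> \<gamma>" by simp
    have "(\<gamma> - 3) * (D - m) \<le> (\<gamma> - 3) * (D - d)"
      using g3 assms by (intro mult_left_mono) auto
    then have "d + 2 * m + (\<gamma> - 1) * (D - m) \<le> d + 2 * D + (\<gamma> - 3) * (D - d)"
      by (simp add: algebra_simps)
    then have "\<epsilon> * (3 * (d + 2 * m + (\<gamma> - 1) * (D - m)))
        \<le> \<epsilon> * (3 * (d + 2 * D + (\<gamma> - 3) * (D - d)))"
      using \<epsilon> by (intro mult_left_mono) auto
    \<comment> \<open>Beyond 3 the coefficient of \<open>D - d\<close> exceeds
      \<open>5 * \<epsilon> + e\<close>, but it is at most \<open>2 / 5 + 4 / 15 = 2 / 3\<close>,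
      which \<open>R \<ge> 1\<close> and \<open>1 - 1 / \<gamma> \<ge> 2 / 3\<close> cover.\<close>
    moreover have "e + (3 * \<gamma> - 4) * \<epsilon> \<le> R * (1 - 1 / \<gamma>)"
    proof -
      have "5 / 2 \<le> exp (1::real)"
        using exp_lower_Taylor_quadratic[of 1] by simp
      then have e_upper: "e \<le> 2 / 5"
        by (simp add: e_def exp_minus field_simps)
      \<comment> \<open>\<open>41 / 32 = 1 + 1 / 4 + 1 / 32\<close> is the quadratic Taylor bound at
        \<open>1 / 4\<close>; the power 12 reaches \<open>exp 3\<close>. At
        \<open>\<gamma> = 3\<close> the estimate below needs \<open>75 \<le> 4 * exp 3\<close>, so
        19 is the smallest integer lower bound that suffices.\<close>
      have "(41 / 32) ^ 12 \<le> exp (1 / 4 :: real) ^ 12"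
        using exp_lower_Taylor_quadratic[of "1 / 4"]
        by (intro power_mono) (auto simp: power2_eq_square)
      also have "\<dots> = exp 3"
        by (simp add: exp_of_nat_mult[symmetric])
      finally have "(41 / 32) ^ 12 \<le> exp (3::real)" .
      moreover have "19 \<le> (41 / 32 :: real) ^ 12" by (simp add: power_divide)
      ultimately have "19 \<le> exp (3::real)" by linarith
      moreover have "\<gamma> - 2 \<le> exp (\<gamma> - 3)"
        using exp_ge_add_one_self[of "\<gamma> - 3"] by simp
      ultimately have "19 * (\<gamma> - 2) \<le> exp 3 * exp (\<gamma> - 3)"
        using g3 by (intro mult_mono) auto
      then have "19 * (\<gamma> - 2) \<le> exp \<gamma>"
        by (simp add: exp_add[symmetric])
      then have "15 * (3 * \<gamma> - 4) \<le> 4 * exp \<gamma>" using g3 by argo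
      then have \<epsilon>3: "(3 * \<gamma> - 4) * \<epsilon> \<le> 4 / 15"
        by (simp add: \<epsilon>_def exp_minus field_simps)
      have "2 / 3 \<le> 1 - 1 / \<gamma>" using g3 by (simp add: field_simps)
      then have "1 * (2 / 3) \<le> R * (1 - 1 / \<gamma>)"
        using R1 \<epsilon> by (intro mult_mono) auto
      with e_upper \<epsilon>3 show ?thesis by simp
    qed
    then have "(e + (3 * \<gamma> - 4) * \<epsilon>) * (D - d) \<le> R * (1 - 1 / \<gamma>) * (D - d)"
      using dD by (intro mult_right_mono) auto
    ultimately show ?thesis by (simp add: algebra_simps)
  qed
  have "(1 - e) * d + (e - \<epsilon>) / (\<gamma> - 1) * q + \<epsilon> * (3 * (d + 2 * m + (q - (\<gamma> - 1) * m)))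
      = (1 - e) * d + (e - \<epsilon>) * D + \<epsilon> * (3 * (d + 2 * m + (\<gamma> - 1) * (D - m)))"
    using assms by (simp add: q right_diff_distrib)
  also note goal
  also have "(1 + 8 * \<epsilon>) * d + R * (1 - 1 / \<gamma>) * (D - d) \<le> R * (d + (1 - 1 / \<gamma>) * (D - d))"
    using mult_right_mono[OF R1 assms(2)] by (simp add: algebra_simps)
  also have "\<dots> \<le> R * X"
    using X R1 \<epsilon> by (intro mult_left_mono) auto
  finally show ?thesis by (simp add: R_def \<epsilon>_def e_def)
qed

text \<open>
  An LP solution need not use a facility to its full opening value, so \<open>C\<^sub>j\<close> may carry more weight
  than \<open>x*\<close> gives to it; the surplus is taken uniformly off the farther copies in \<open>D\<^sub>j\<close>.
\<close>

lemma trimmed_weights: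
  fixes y r v :: "'s \<Rightarrow> real"
  assumes y: "\<And>s. s \<in> J \<union> D \<Longrightarrow> 0 \<le> y s" "(\<Sum>s\<in>J. y s) = 1"
    and r: "\<And>s. s \<in> J \<union> D \<Longrightarrow> 0 \<le> r s" "\<And>s. s \<in> J \<union> D \<Longrightarrow> r s \<le> 1"
    and total: "(\<Sum>s\<in>J. y s * r s) + (\<Sum>s\<in>D. y s * r s) = \<gamma>" and "1 < \<gamma>"
    and m: "\<And>s. s \<in> J \<Longrightarrow> v s \<le> m" "\<And>s. s \<in> D \<Longrightarrow> m \<le> v s"
  obtains \<kappa> :: real where "0 \<le> \<kappa>" "\<kappa> \<le> 1" "(\<Sum>s\<in>D. y s * (\<kappa> * r s)) = \<gamma> - 1"
    "(\<Sum>s\<in>J. y s * v s) + (\<Sum>s\<in>D. y s * (\<kappa> * r s) * v s)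
       \<le> (\<Sum>s\<in>J. y s * r s * v s) + (\<Sum>s\<in>D. y s * r s * v s)"
proof
  define T where "T = (\<Sum>s\<in>D. y s * r s)"
  \<comment> \<open>The scaling leaves weight exactly \<open>\<gamma> - 1\<close> on
    \<open>D\<close>; it is at most 1 because the used weight on \<open>J\<close> is at most
    1.\<close>
  define \<kappa> where "\<kappa> = (\<gamma> - 1) / T"
  have "(\<Sum>s\<in>J. y s * r s) \<le> (\<Sum>s\<in>J. y s)"
    using y r by (intro sum_mono mult_left_le) auto
  then have T: "\<gamma> - 1 \<le> T" using total y(2) by (simp add: T_def)
  then show \<kappa>: "0 \<le> \<kappa>" "\<kappa> \<le> 1" using \<open>1 < \<gamma>\<close> by (auto simp: \<kappa>_def)
  have \<kappa>T: "\<kappa> * T = \<gamma> - 1" using T \<open>1 < \<gamma>\<close> by (simp add: \<kappa>_def)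
  then show "(\<Sum>s\<in>D. y s * (\<kappa> * r s)) = \<gamma> - 1"
    by (simp add: T_def sum_distrib_left mult_ac)
  have "(\<Sum>s\<in>J. y s * (1 - r s) * v s) \<le> (\<Sum>s\<in>J. y s * (1 - r s) * m)"
    using y r m by (intro sum_mono mult_left_mono mult_nonneg_nonneg) auto
  also have "\<dots> = (1 - (\<Sum>s\<in>J. y s * r s)) * m"
    using y(2) by (simp add: right_diff_distrib sum_subtractf sum_distrib_right[symmetric])
  also have "1 - (\<Sum>s\<in>J. y s * r s) = (1 - \<kappa>) * T"
    using total \<kappa>T unfolding T_def[symmetric] by (simp add: left_diff_distrib)
  also have "\<dots> * m = (\<Sum>s\<in>D. (1 - \<kappa>) * (y s * r s) * m)"
    by (simp add: T_def sum_distrib_left sum_distrib_right)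
  also have "\<dots> \<le> (\<Sum>s\<in>D. (1 - \<kappa>) * (y s * r s) * v s)"
    using y r m \<kappa> by (intro sum_mono mult_left_mono mult_nonneg_nonneg) auto
  finally show "(\<Sum>s\<in>J. y s * v s) + (\<Sum>s\<in>D. y s * (\<kappa> * r s) * v s)
       \<le> (\<Sum>s\<in>J. y s * r s * v s) + (\<Sum>s\<in>D. y s * r s * v s)"
    by (simp add: algebra_simps sum_subtractf)
qed

text \<open>As \<open>t\<close> grows, all weight of \<open>J\<close> is counted before any of
  \<open>D\<close>. Hence the counted weight \<open>P + Q\<close> has \<open>Q = 0\<close> or
  \<open>P = 1\<close>, and the right side is then exactly the chord over \<open>[0, 1]\<close> or
  \<open>[1, \<gamma>]\<close>, written through the uncounted weights.\<close>

lemma exp_neg_weight_le: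
  fixes p q v :: "'s \<Rightarrow> real"
  assumes p: "\<And>s. s \<in> J \<Longrightarrow> 0 \<le> p s" "(\<Sum>s\<in>J. p s) = 1"
    and q: "\<And>s. s \<in> D \<Longrightarrow> 0 \<le> q s" "(\<Sum>s\<in>D. q s) = \<gamma> - 1" and "1 < \<gamma>"
    and closer: "\<And>s s'. s \<in> J \<Longrightarrow> s' \<in> D \<Longrightarrow> v s \<le> v s'"
  shows "exp (- ((\<Sum>s\<in>J. p s * of_bool (v s \<le> t)) + (\<Sum>s\<in>D. q s * of_bool (v s \<le> t))))
     \<le> (1 - exp (- 1)) * (\<Sum>s\<in>J. p s * of_bool (t < v s))
        + (exp (- 1) - exp (- \<gamma>)) / (\<gamma> - 1) * (\<Sum>s\<in>D. q s * of_bool (t < v s)) + exp (- \<gamma>)"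
proof -
  define P where "P = (\<Sum>s\<in>J. p s * of_bool (v s \<le> t))"
  define Q where "Q = (\<Sum>s\<in>D. q s * of_bool (v s \<le> t))"
  have compl: "(\<Sum>s\<in>B. w s * of_bool (t < v s)) = (\<Sum>s\<in>B. w s) - (\<Sum>s\<in>B. w s * of_bool (v s \<le> t))"
    for B and w :: "'s \<Rightarrow> real"
    unfolding sum_subtractf[symmetric] by (intro sum.cong) auto
  have P: "0 \<le> P" "P \<le> 1"
    using p unfolding P_def p(2)[symmetric] by (auto intro!: sum_nonneg sum_mono)
  have Q: "0 \<le> Q" "Q \<le> \<gamma> - 1"
    using q unfolding Q_def q(2)[symmetric] by (auto intro!: sum_nonneg sum_mono)
  define \<sigma> where "\<sigma> = (exp (- 1) - exp (- \<gamma>)) / (\<gamma> - 1)"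
  have "\<sigma> * (\<gamma> - 1) = exp (- 1) - exp (- \<gamma>)"
    using \<open>1 < \<gamma>\<close> by (simp add: \<sigma>_def)
  then have \<sigma>: "\<sigma> * (\<gamma> - 1 - Q) = exp (- 1) - exp (- \<gamma>) - \<sigma> * Q"
    by (simp add: right_diff_distrib)
  have "exp (- (P + Q)) \<le> (1 - exp (- 1)) * (1 - P) + \<sigma> * (\<gamma> - 1 - Q) + exp (- \<gamma>)"
  proof (cases "\<exists>s'\<in>D. v s' \<le> t")
    case True
    then have "P = (\<Sum>s\<in>J. p s)"
      unfolding P_def using closer by (intro sum.cong) (auto intro: order_trans)
    then have "P = 1" using p(2) by simp
    moreover have "exp (- (1 + Q)) \<le> exp (- 1) - \<sigma> * Q"
      using exp_le_chord[of 1 \<gamma> "1 + Q"] \<open>1 < \<gamma>\<close> Q by (simp add: \<sigma>_def)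
    ultimately show ?thesis unfolding \<sigma> by simp
  next
    case False
    then have "Q = 0" unfolding Q_def by (intro sum.neutral) auto
    moreover have "exp (- P) \<le> 1 - (1 - exp (- 1)) * P"
      using exp_le_chord[of 0 1 P] P by simp
    ultimately show ?thesis unfolding \<sigma> by (simp add: right_diff_distrib)
  qed
  then show ?thesis by (simp add: compl p(2) q(2) P_def Q_def \<sigma>_def)
qed

section \<open>Expected costs\<close>

context cluster_rounding
begin

lemma expectation_card_cs_rounding:
  assumes "B \<subseteq> S"
  shows "measure_pmf.expectation (cs_rounding S ybar xbar centres) (\<lambda>Op. real (card (Op \<inter> B)))
       = (\<Sum>s\<in>B. ybar s)"
proof -
  have "finite B" using assms finite_S by (rule finite_subset)
  have "real (card (Op \<inter> B)) = (\<Sum>s\<in>B. indicator {Op. s \<in> Op} Op)" for Op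
    using \<open>finite B\<close> by (simp add: indicator_def sum.If_cases Int_commute Int_def)
  then have "measure_pmf.expectation (cs_rounding S ybar xbar centres) (\<lambda>Op. real (card (Op \<inter> B)))
      = (\<Sum>s\<in>B. measure_pmf.prob (cs_rounding S ybar xbar centres) {Op. s \<in> Op})"
    by (simp add: integrable_measure_pmf_finite[OF finite_set_cs_rounding])
  also have "\<dots> = (\<Sum>s\<in>B. ybar s)"
    using assms prob_open_cs_rounding by (intro sum.cong) auto
  finally show ?thesis .
qed

text \<open>Clusters are rounded independently, so the extra cost changes only the factor of cluster
  \<open>k\<close>, and the rest \<open>Y\<close> is common to both sides. Hypothesis
  \<open>le\<close> is the bound on a conditional mean, multiplied out because the conditioning
  event may have probability 0.\<close>

lemma expectation_prod_in_cluster_le: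
  assumes k: "k \<in> set centres"
    and v: "\<And>s. s \<in> S \<Longrightarrow> 0 \<le> v s"
    and \<theta>: "\<And>s. s \<in> S \<Longrightarrow> \<theta> s \<le> 1"
    and le: "(\<Sum>s\<in>Cset S xbar k. ybar s * (1 - \<theta> s) * v s)
           \<le> L * (\<Sum>s\<in>Cset S xbar k. ybar s * (1 - \<theta> s))"
  shows "measure_pmf.expectation (cs_rounding S ybar xbar centres)
           (\<lambda>Op. \<Prod>s\<in>Op. (1 - \<theta> s) * (if s \<in> Cset S xbar k then v s else 1))
       \<le> L * measure_pmf.expectation (cs_rounding S ybar xbar centres) (\<lambda>Op. \<Prod>s\<in>Op. 1 - \<theta> s)"
proof -
  let ?F = "\<lambda>s. (1 - \<theta> s) * (if s \<in> Cset S xbar k then v s else 1)"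
  define Y where "Y = (\<Prod>k'\<in>set centres - {k}. \<Sum>s\<in>Cset S xbar k'. ybar s * (1 - \<theta> s))
      * (\<Prod>s\<in>U. ybar s * (1 - \<theta> s) + (1 - ybar s))"
  have Y: "0 \<le> Y"
    unfolding Y_def using \<theta> ybar_nonneg ybar_le_1
    by (intro mult_nonneg_nonneg prod_nonneg sum_nonneg ballI add_nonneg_nonneg) (auto simp: Cset_def)
  have others: "(\<Sum>s\<in>Cset S xbar k'. ybar s * ?F s) = (\<Sum>s\<in>Cset S xbar k'. ybar s * (1 - \<theta> s))"
    if "k' \<in> set centres - {k}" for k'
    using that k Cset_disjoint[of k k'] by (intro sum.cong) auto
  have "measure_pmf.expectation (cs_rounding S ybar xbar centres) (\<lambda>Op. \<Prod>s\<in>Op. ?F s)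
      = (\<Prod>k'\<in>set centres. \<Sum>s\<in>Cset S xbar k'. ybar s * ?F s) * (\<Prod>s\<in>U. ybar s * ?F s + (1 - ybar s))"
    using \<theta> v by (intro expectation_prod_cs_rounding) auto
  also have "\<dots> = (\<Sum>s\<in>Cset S xbar k. ybar s * (1 - \<theta> s) * v s) * Y"
  proof -
    have "(\<Prod>s\<in>U. ybar s * ?F s + (1 - ybar s)) = (\<Prod>s\<in>U. ybar s * (1 - \<theta> s) + (1 - ybar s))"
      using k by (intro prod.cong) auto
    moreover have "(\<Prod>k'\<in>set centres. \<Sum>s\<in>Cset S xbar k'. ybar s * ?F s)
        = (\<Sum>s\<in>Cset S xbar k. ybar s * (1 - \<theta> s) * v s)
          * (\<Prod>k'\<in>set centres - {k}. \<Sum>s\<in>Cset S xbar k'. ybar s * (1 - \<theta> s))"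
      using k by (subst prod.remove[of _ k])
        (auto simp: others mult.assoc intro!: arg_cong2[where f = "(*)"] sum.cong prod.cong)
    ultimately show ?thesis by (simp add: Y_def)
  qed
  also have "\<dots> \<le> L * (\<Sum>s\<in>Cset S xbar k. ybar s * (1 - \<theta> s)) * Y"
    using le Y by (rule mult_right_mono)
  also have "\<dots> = L * ((\<Prod>k'\<in>set centres. \<Sum>s\<in>Cset S xbar k'. ybar s * (1 - \<theta> s))
        * (\<Prod>s\<in>U. ybar s * (1 - \<theta> s) + (1 - ybar s)))"
    using k by (simp add: Y_def prod.remove[of "set centres" k])
  also have "\<dots> = L * measure_pmf.expectation (cs_rounding S ybar xbar centres) (\<lambda>Op. \<Prod>s\<in>Op. 1 - \<theta> s)"
    using \<theta> by (subst expectation_prod_cs_rounding) auto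
  finally show ?thesis .
qed

text \<open>\<open>w\<close> charges the open facility of cluster \<open>k\<close> when nothing
  within \<open>L\<close> counts. Its expectation is at most \<open>L\<close> times the probability
  of that event, so the fallback terms cancel and only the integral remains.\<close>

lemma expectation_Min_le_integral:
  assumes k: "k \<in> set centres" and "0 \<le> L"
    and v: "\<And>s. s \<in> S \<Longrightarrow> 0 \<le> v s"
    and \<mu>: "\<And>s. s \<in> S \<Longrightarrow> 0 \<le> \<mu> s" "\<And>s. s \<in> S \<Longrightarrow> \<mu> s \<le> 1"
    and detour: "(\<Sum>s\<in>Cset S xbar k. ybar s * (1 - \<mu> s * of_bool (v s \<le> L)) * v s)
           \<le> L * (\<Sum>s\<in>Cset S xbar k. ybar s * (1 - \<mu> s * of_bool (v s \<le> L)))"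
    and \<psi>: "\<And>t. exp (- (\<Sum>s\<in>S. ybar s * (\<mu> s * of_bool (v s \<le> t)))) \<le> \<psi> t"
      "(\<psi> has_integral I) {0..L}"
  shows "measure_pmf.expectation (cs_rounding S ybar xbar centres) (\<lambda>Op. Min (v ` Op)) \<le> I"
proof -
  let ?p = "cs_rounding S ybar xbar centres"
  let ?E = "measure_pmf.expectation ?p"
  define g where "g = (\<lambda>Op t. \<Prod>s\<in>Op. 1 - \<mu> s * of_bool (v s \<le> t))"
  define w where "w = (\<lambda>Op. \<Prod>s\<in>Op. (1 - \<mu> s * of_bool (v s \<le> L)) * (if s \<in> Cset S xbar k then v s else 1))"
  note int [simp] = integrable_measure_pmf_finite[OF finite_set_cs_rounding]
  have pointwise: "Min (v ` Op) \<le> integral {0..L} (g Op) + (w Op - L * g Op L)"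
    if Op: "Op \<in> set_pmf ?p" for Op
  proof -
    note sub = cs_rounding_subset[OF Op]
    have fin: "finite Op" using sub finite_S by (rule finite_subset)
    obtain i where i: "Op \<inter> Cset S xbar k = {i}"
      using cs_rounding_Int_Cset[OF Op k] .
    \<comment> \<open>A cluster holds exactly one open facility, so its cost can be written as a
      product over the whole open set, the shape that the factorization handles.\<close>
    have "(\<Prod>s\<in>Op. if s \<in> Cset S xbar k then v s else 1) = v i"
      using i fin by (simp add: prod.inter_restrict[symmetric])
    then have "w Op = v i * g Op L"
      by (simp add: w_def g_def prod.distrib)
    moreover have "Min (v ` Op) \<le> integral {0..L} (g Op) + (v i - L) * g Op L"
      unfolding g_def using i sub v \<mu> \<open>0 \<le> L\<close> fin
      by (intro Min_le_integral_prod_threshold) auto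
    ultimately show ?thesis by (simp add: left_diff_distrib)
  qed
  have "?E (\<lambda>Op. Min (v ` Op)) \<le> ?E (\<lambda>Op. integral {0..L} (g Op) + (w Op - L * g Op L))"
    by (intro integral_mono_AE) (auto simp: AE_measure_pmf_iff pointwise)
  also have "\<dots> = ?E (\<lambda>Op. integral {0..L} (g Op)) + (?E w - L * ?E (\<lambda>Op. g Op L))"
    by simp
  also have "?E w \<le> L * ?E (\<lambda>Op. g Op L)"
    unfolding w_def g_def
    by (rule expectation_prod_in_cluster_le[OF k v _ detour]) (use \<mu> in \<open>auto simp: of_bool_def\<close>)
  also have "?E (\<lambda>Op. integral {0..L} (g Op)) \<le> I"
  proof (rule has_integral_le[OF expectation_integral_finite \<psi>(2)])
    show "finite (set_pmf ?p)" by (rule finite_set_cs_rounding)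
    show "g Op integrable_on {0..L}" if "Op \<in> set_pmf ?p" for Op
      unfolding g_def using cs_rounding_subset[OF that] \<mu> by (intro integrable_prod_threshold) auto
    show "?E (\<lambda>Op. g Op t) \<le> \<psi> t" for t
      unfolding g_def using \<mu>
      by (intro order_trans[OF expectation_prod_compl_le_exp \<psi>(1)]) (auto simp: of_bool_def)
  qed
  finally show ?thesis by simp
qed

end

section \<open>Connection cost of a single city\<close>

lemma expected_connection_cost:
  fixes C :: "'c set" and F :: "'f set" and c :: "'f \<Rightarrow> 'c \<Rightarrow> real" and f :: "'f \<Rightarrow> real"
    and \<gamma> :: real and xs :: "'f \<Rightarrow> 'c \<Rightarrow> real" and ys :: "'f \<Rightarrow> real"
    and S :: "'s set" and orig :: "'s \<Rightarrow> 'f" and ybar :: "'s \<Rightarrow> real"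
    and xbar :: "'s \<Rightarrow> 'c \<Rightarrow> real" and centres :: "'c list"
  assumes "cluster_rounding S ybar xbar centres"
    and inst: "squared_metric_instance C F c f"
    and gamma: "1 < \<gamma>"
    and feasible: "lp_feasible C F xs ys"
    and split: "cs_scaled_split C F c \<gamma> xs ys S orig ybar xbar"
    and j: "j \<in> C" and k: "k \<in> C" "k \<in> set centres"
    and key: "d_c c S orig ybar xbar k + d_max c S orig xbar k
            \<le> d_c c S orig ybar xbar j + d_max c S orig xbar j"
    and meet: "Cset S xbar k \<inter> Cset S xbar j \<noteq> {}"
  shows "measure_pmf.expectation (cs_rounding S ybar xbar centres)
                 (\<lambda>Op. Min ((\<lambda>s. c (orig s) j) ` Op))
              \<le> max (1 + 8 * exp (-\<gamma>)) ((5 * exp (-\<gamma>) + exp (-1)) / (1 - 1 / \<gamma>))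
                  * (\<Sum>i\<in>F. xs i j * c i j)"
proof -
  interpret cluster_rounding S ybar xbar centres by fact
  define v where "v = (\<lambda>s. c (orig s) j)"
  define b where "b = (\<lambda>s. c (orig s) k)"
  define J where "J = Cset S xbar j"
  define D where "D = Dset S orig xs xbar j"
  define K where "K = Cset S xbar k"
  define m where "m = d_max c S orig xbar j"
  define u where "u = d_max c S orig xbar k"
  \<comment> \<open>The fraction of the opening value of \<open>orig s\<close> used by city
    \<open>j\<close>, the same for all copies. If \<open>ys (orig s) = 0\<close>, the value 0 is
    right, since then \<open>xs (orig s) j = 0\<close>.\<close>
  define r where "r = (\<lambda>s. xs (orig s) j / ys (orig s))"
  have finF: "finite F"
    and c_nonneg: "\<And>i j. i \<in> F \<Longrightarrow> j \<in> C \<Longrightarrow> 0 \<le> c i j"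
    and metric: "\<And>i i' j j'. i \<in> F \<Longrightarrow> i' \<in> F \<Longrightarrow> j \<in> C \<Longrightarrow> j' \<in> C \<Longrightarrow>
        sqrt (c i j) \<le> sqrt (c i j') + sqrt (c i' j') + sqrt (c i' j)"
    using inst unfolding squared_metric_instance_def by blast+
  have x_sum: "(\<Sum>i\<in>F. xs i j) = 1"
    and x_le: "\<And>i. i \<in> F \<Longrightarrow> xs i j \<le> ys i" and x_nonneg: "\<And>i. i \<in> F \<Longrightarrow> 0 \<le> xs i j"
    using feasible j unfolding lp_feasible_def by blast+
  have orig: "\<And>s. s \<in> S \<Longrightarrow> orig s \<in> F"
    and ybar_pos: "\<And>s. s \<in> S \<Longrightarrow> 0 < ybar s"
    and copies: "\<And>i. i \<in> F \<Longrightarrow> (\<Sum>s\<in>{s\<in>S. orig s = i}. ybar s) = \<gamma> * ys i"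
    and xbar01: "\<And>s j. s \<in> S \<Longrightarrow> j \<in> C \<Longrightarrow> xbar s j = 0 \<or> xbar s j = ybar s"
    and xbar_sum_1: "\<And>j. j \<in> C \<Longrightarrow> (\<Sum>s\<in>S. xbar s j) = 1"
    and closest: "\<And>s s'. s \<in> S \<Longrightarrow> s' \<in> S \<Longrightarrow> 0 < xbar s j \<Longrightarrow> 0 < xs (orig s') j \<Longrightarrow>
        xbar s' j = 0 \<Longrightarrow> c (orig s) j \<le> c (orig s') j"
    using split j unfolding cs_scaled_split_def by blast+
  have v_nonneg: "0 \<le> v s" if "s \<in> S" for s
    using that orig c_nonneg j by (simp add: v_def)
  have JS: "J \<subseteq> S" and DS: "D \<subseteq> S" and KS: "K \<subseteq> S" and JD: "J \<inter> D = {}"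
    by (auto simp: J_def D_def K_def Cset_def Dset_def)
  have fin: "finite J" "finite D" "finite K"
    using JS DS KS finite_S by (auto intro: finite_subset)
  have sum_Cset: "(\<Sum>s\<in>Cset S xbar j'. ybar s) = 1" if "j' \<in> C" for j'
  proof -
    have "(\<Sum>s\<in>Cset S xbar j'. ybar s) = (\<Sum>s\<in>S. xbar s j')"
      using xbar01[OF _ that] ybar_pos
      by (intro sum.mono_neutral_cong_left finite_S) (force simp: Cset_def)+
    then show ?thesis using xbar_sum_1[OF that] by simp
  qed
  have sumJ: "(\<Sum>s\<in>J. ybar s) = 1" and sumK: "(\<Sum>s\<in>K. ybar s) = 1"
    using sum_Cset j k by (auto simp: J_def K_def)
  have d_c_eq: "d_c c S orig ybar xbar j' = (\<Sum>s\<in>Cset S xbar j'. ybar s * c (orig s) j')"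
    if "j' \<in> C" for j'
    by (simp add: d_c_def avg_dist_def sum_Cset[OF that] mult.commute)
  have vm: "v s \<le> m" if "s \<in> J" for s
    unfolding m_def d_max_def v_def using that fin by (intro Max_ge) (auto simp: J_def)
  have bu: "b s \<le> u" if "s \<in> K" for s
    unfolding u_def d_max_def b_def using that fin by (intro Max_ge) (auto simp: K_def)
  have J_ne: "J \<noteq> {}" using meet by (auto simp: J_def)
  have m_v: "m \<le> v s'" if "s' \<in> D" for s'
  proof -
    have "m \<in> v ` J"
      unfolding m_def d_max_def v_def J_def using fin J_ne by (intro Max_in) (auto simp: J_def)
    then show ?thesis
      using closest that by (auto simp: J_def D_def Cset_def Dset_def v_def)
  qed
  have m_nonneg: "0 \<le> m" using J_ne JS vm v_nonneg by (meson all_not_in_conv order_trans subsetD)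

  have r01: "0 \<le> r s" "r s \<le> 1" if "s \<in> S" for s
    using x_nonneg[of "orig s"] x_le[of "orig s"] orig[OF that]
    by (auto simp: r_def divide_le_eq_1 intro!: divide_nonneg_nonneg)
  \<comment> \<open>Needed for two weights: \<open>w = 1\<close> gives the total mass
    \<open>\<gamma>\<close>, and the cost to \<open>j\<close> gives \<open>\<gamma>\<close> times
    the fractional connection cost.\<close>
  have r_sum: "(\<Sum>s\<in>J. ybar s * r s * w (orig s)) + (\<Sum>s\<in>D. ybar s * r s * w (orig s))
      = \<gamma> * (\<Sum>i\<in>F. xs i j * w i)" for w :: "'f \<Rightarrow> real"
  proof -
    have "(\<Sum>s\<in>J. ybar s * r s * w (orig s)) + (\<Sum>s\<in>D. ybar s * r s * w (orig s))
        = (\<Sum>s\<in>J \<union> D. ybar s * r s * w (orig s))"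
      using fin JD by (simp add: sum.union_disjoint)
    also have "\<dots> = (\<Sum>s\<in>S. ybar s * r s * w (orig s))"
    proof (intro sum.mono_neutral_left finite_S ballI)
      fix s assume s: "s \<in> S - (J \<union> D)"
      then have "xs (orig s) j \<le> 0"
        using xbar01[of s j] ybar_pos[of s] j by (force simp: J_def D_def Cset_def Dset_def)
      then have "xs (orig s) j = 0" using x_nonneg[of "orig s"] s orig by force
      then show "ybar s * r s * w (orig s) = 0" by (simp add: r_def)
    qed (use JS DS in auto)
    also have "\<dots> = (\<Sum>i\<in>F. \<Sum>s\<in>{s\<in>S. orig s = i}. ybar s * r s * w (orig s))"
      using finite_S finF orig by (intro sum.group[symmetric]) auto
    also have "\<dots> = (\<Sum>i\<in>F. \<gamma> * (xs i j * w i))"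
    proof (intro sum.cong refl)
      fix i assume i: "i \<in> F"
      have "(\<Sum>s\<in>{s\<in>S. orig s = i}. ybar s * r s * w (orig s))
          = (\<Sum>s\<in>{s\<in>S. orig s = i}. ybar s) * (xs i j / ys i * w i)"
        unfolding sum_distrib_right by (intro sum.cong) (auto simp: r_def)
      also have "\<dots> = \<gamma> * (xs i j * w i)"
        using copies[OF i] x_le[OF i] x_nonneg[OF i] by (cases "ys i = 0") auto
      finally show "(\<Sum>s\<in>{s\<in>S. orig s = i}. ybar s * r s * w (orig s)) = \<gamma> * (xs i j * w i)" .
    qed
    finally show ?thesis by (simp add: sum_distrib_left)
  qed

  have r_total: "(\<Sum>s\<in>J. ybar s * r s) + (\<Sum>s\<in>D. ybar s * r s) = \<gamma>"
    using r_sum[of "\<lambda>_. 1"] x_sum by simp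
  obtain \<kappa> where \<kappa>: "0 \<le> \<kappa>" "\<kappa> \<le> 1" "(\<Sum>s\<in>D. ybar s * (\<kappa> * r s)) = \<gamma> - 1"
    and trimmed: "(\<Sum>s\<in>J. ybar s * v s) + (\<Sum>s\<in>D. ybar s * (\<kappa> * r s) * v s)
       \<le> (\<Sum>s\<in>J. ybar s * r s * v s) + (\<Sum>s\<in>D. ybar s * r s * v s)"
  proof (rule trimmed_weights[OF _ sumJ _ _ r_total gamma vm m_v])
    show "0 \<le> ybar s" "0 \<le> r s" "r s \<le> 1" if "s \<in> J \<union> D" for s
      using that JS DS ybar_nonneg r01 by auto
  qed
  \<comment> \<open>The probability with which an open copy counts as a direct connection, chosen so
    that \<open>J\<close> has weight 1 and \<open>D\<close> weight
    \<open>\<gamma> - 1\<close>.\<close>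
  define \<mu> where "\<mu> = (\<lambda>s. if s \<in> J then 1 else if s \<in> D then \<kappa> * r s else 0)"
  have \<mu>01: "0 \<le> \<mu> s" "\<mu> s \<le> 1" if "s \<in> S" for s
    using r01[OF that] \<kappa>(1,2) by (auto simp: \<mu>_def mult_le_one)
  have \<mu>J: "\<mu> s = 1" if "s \<in> J" for s using that by (simp add: \<mu>_def)
  have \<mu>D: "\<mu> s = \<kappa> * r s" if "s \<in> D" for s using that JD by (auto simp: \<mu>_def)
  define d where "d = (\<Sum>s\<in>J. ybar s * v s)"
  define q where "q = (\<Sum>s\<in>D. ybar s * \<mu> s * v s)"
  define L where "L = 3 * (d + 2 * m + (q - (\<gamma> - 1) * m))"
  have sum_\<mu>D: "(\<Sum>s\<in>D. ybar s * \<mu> s) = \<gamma> - 1" using \<kappa>(3) by (simp add: \<mu>D)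
  have dq: "d + q \<le> \<gamma> * (\<Sum>i\<in>F. xs i j * c i j)"
    using trimmed r_sum[of "\<lambda>i. c i j"] by (simp add: d_def q_def \<mu>D v_def)
  have excess: "q - (\<gamma> - 1) * m = (\<Sum>s\<in>D. ybar s * \<mu> s * (v s - m))"
    by (simp add: q_def right_diff_distrib sum_subtractf sum_\<mu>D sum_distrib_right[symmetric])
  have excess_nonneg: "0 \<le> ybar s * \<mu> s * (v s - m)" if "s \<in> D" for s
    using that DS ybar_nonneg \<mu>01 m_v by (intro mult_nonneg_nonneg) auto
  have "0 \<le> q - (\<gamma> - 1) * m"
    unfolding excess by (intro sum_nonneg excess_nonneg)
  then have qm: "(\<gamma> - 1) * m \<le> q" by simp
  have d_nonneg: "0 \<le> d"
    unfolding d_def using JS ybar_nonneg v_nonneg by (intro sum_nonneg mult_nonneg_nonneg) auto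
  have "d \<le> (\<Sum>s\<in>J. ybar s * m)"
    unfolding d_def using JS ybar_nonneg vm by (intro sum_mono mult_left_mono) auto
  then have dm: "d \<le> m" by (simp add: sum_distrib_right[symmetric] sumJ)
  have mL: "m \<le> L" and L_nonneg: "0 \<le> L"
    using d_nonneg m_nonneg qm by (auto simp: L_def)

  define \<theta> where "\<theta> = (\<lambda>s. \<mu> s * of_bool (v s \<le> L))"
  have \<theta>01: "0 \<le> \<theta> s" "\<theta> s \<le> 1" if "s \<in> S" for s
    using \<mu>01[OF that] by (auto simp: \<theta>_def)
  have "(\<Sum>s\<in>K. ybar s * (1 - \<theta> s) * v s)
      \<le> 3 * (m + u + (\<Sum>s\<in>K. ybar s * b s) + (q - (\<gamma> - 1) * m)) * (\<Sum>s\<in>K. ybar s * (1 - \<theta> s))"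
  proof (rule detour_cost_le[where A = "K \<inter> J"])
    show "v i \<le> 3 * (v i' + b i' + b i)" if "i \<in> K" "i' \<in> K" for i i'
    proof -
      have F: "orig i \<in> F" "orig i' \<in> F" using that KS orig by auto
      have "v i \<le> 3 * (b i + b i' + v i')"
        unfolding v_def b_def
        by (rule sq_sum3_le) (use F c_nonneg metric j k in auto)
      then show ?thesis by simp
    qed
    \<comment> \<open>Off \<open>J\<close> only copies in \<open>D\<close> count; every excess over
      \<open>m\<close> there is nonnegative, so the sum may be extended to all of
      \<open>D\<close>.\<close>
    show "(\<Sum>s\<in>K - K \<inter> J. ybar s * \<theta> s * (v s - m)) \<le> q - (\<gamma> - 1) * m"
    proof -
      have "(\<Sum>s\<in>K - K \<inter> J. ybar s * \<theta> s * (v s - m)) = (\<Sum>s\<in>(K - J) \<inter> D. ybar s * \<theta> s * (v s - m))"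
        using fin by (intro sum.mono_neutral_right) (auto simp: \<theta>_def \<mu>_def)
      also have "\<dots> \<le> (\<Sum>s\<in>(K - J) \<inter> D. ybar s * \<mu> s * (v s - m))"
        using excess_nonneg by (intro sum_mono) (auto simp: \<theta>_def)
      also have "\<dots> \<le> (\<Sum>s\<in>D. ybar s * \<mu> s * (v s - m))"
        using fin excess_nonneg by (intro sum_mono2) auto
      finally show ?thesis by (simp add: excess)
    qed
    show "K \<inter> J \<noteq> {}" using meet by (simp add: K_def J_def)
    show "\<theta> s = 1" if "s \<in> K \<inter> J" for s
      using that vm[of s] mL by (simp add: \<theta>_def \<mu>J)
  qed (use fin KS ybar_nonneg sumK \<theta>01 bu vm in auto)
  also have "\<dots> \<le> L * (\<Sum>s\<in>K. ybar s * (1 - \<theta> s))"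
  proof (rule mult_right_mono)
    \<comment> \<open>The greedy choice of the centre enters here: average plus maximal cost of
      \<open>k\<close> is exchanged for that of \<open>j\<close>.\<close>
    have "(\<Sum>s\<in>K. ybar s * b s) + u \<le> d + m"
      using key d_c_eq[OF j] d_c_eq[OF k(1)]
      by (simp add: d_def m_def u_def K_def J_def b_def v_def)
    then show "3 * (m + u + (\<Sum>s\<in>K. ybar s * b s) + (q - (\<gamma> - 1) * m)) \<le> L"
      by (simp add: L_def)
    show "0 \<le> (\<Sum>s\<in>K. ybar s * (1 - \<theta> s))"
      using KS ybar_nonneg \<theta>01 by (intro sum_nonneg mult_nonneg_nonneg) auto
  qed
  finally have detour: "(\<Sum>s\<in>K. ybar s * (1 - \<theta> s) * v s) \<le> L * (\<Sum>s\<in>K. ybar s * (1 - \<theta> s))" .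

  define \<sigma> where "\<sigma> = (exp (- 1) - exp (- \<gamma>)) / (\<gamma> - 1)"
  have \<sigma>_nonneg: "0 \<le> \<sigma>" using gamma by (simp add: \<sigma>_def)
  define \<psi> where "\<psi> = (\<lambda>t. (1 - exp (- 1)) * (\<Sum>s\<in>J. ybar s * of_bool (t < v s))
        + \<sigma> * (\<Sum>s\<in>D. ybar s * \<mu> s * of_bool (t < v s)) + exp (- \<gamma>))"
  have survival: "exp (- (\<Sum>s\<in>S. ybar s * (\<mu> s * of_bool (v s \<le> t)))) \<le> \<psi> t" for t
  proof -
    have "(\<Sum>s\<in>S. ybar s * (\<mu> s * of_bool (v s \<le> t)))
        = (\<Sum>s\<in>J \<union> D. ybar s * (\<mu> s * of_bool (v s \<le> t)))"
      using finite_S JS DS by (intro sum.mono_neutral_right) (auto simp: \<mu>_def)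
    also have "\<dots> = (\<Sum>s\<in>J. ybar s * of_bool (v s \<le> t)) + (\<Sum>s\<in>D. ybar s * \<mu> s * of_bool (v s \<le> t))"
      using fin JD by (simp add: sum.union_disjoint \<mu>J mult.assoc)
    also have "exp (- \<dots>) \<le> \<psi> t"
      unfolding \<psi>_def \<sigma>_def using JS DS ybar_nonneg \<mu>01 sumJ sum_\<mu>D gamma order_trans[OF vm m_v]
      by (intro exp_neg_weight_le) auto
    finally show ?thesis .
  qed
  define I where "I = (1 - exp (- 1)) * (\<Sum>s\<in>J. ybar s * min (v s) L)
        + \<sigma> * (\<Sum>s\<in>D. ybar s * \<mu> s * min (v s) L) + L * exp (- \<gamma>)"
  have \<psi>_int: "(\<psi> has_integral I) {0..L}"
    unfolding \<psi>_def I_def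
    using has_integral_const_real[of "exp (- \<gamma>)" 0 L] L_nonneg JS DS v_nonneg fin
    by (intro has_integral_add has_integral_mult_right has_integral_sum has_integral_step) auto
  have "measure_pmf.expectation (cs_rounding S ybar xbar centres) (\<lambda>Op. Min (v ` Op)) \<le> I"
    using k(2) L_nonneg v_nonneg \<mu>01 detour[unfolded \<theta>_def K_def] survival \<psi>_int
    by (rule expectation_Min_le_integral)
  also have "\<dots> \<le> (1 - exp (- 1)) * d + \<sigma> * q + exp (- \<gamma>) * L"
  proof -
    have "(\<Sum>s\<in>J. ybar s * min (v s) L) \<le> d"
      unfolding d_def using JS ybar_nonneg by (intro sum_mono mult_left_mono) auto
    moreover have "(\<Sum>s\<in>D. ybar s * \<mu> s * min (v s) L) \<le> q"
      unfolding q_def using DS ybar_nonneg \<mu>01 by (intro sum_mono mult_left_mono mult_nonneg_nonneg) auto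
    ultimately show ?thesis
      unfolding I_def using \<sigma>_nonneg by (intro add_mono mult_left_mono) auto
  qed
  also have "\<dots> \<le> max (1 + 8 * exp (-\<gamma>)) ((5 * exp (-\<gamma>) + exp (-1)) / (1 - 1 / \<gamma>))
                  * (\<Sum>i\<in>F. xs i j * c i j)"
    unfolding L_def \<sigma>_def by (rule approximation_ratio[OF gamma d_nonneg dm qm dq])
  finally show ?thesis by (simp add: v_def)
qed

text \<open>Open copies of a facility are counted with multiplicity, so the opening cost is linear
  in the opening probabilities and equality holds. At \<open>\<gamma> = 1\<close> the quotient would
  be 0 by the convention for division by zero, hence the guard \<open>1 < \<gamma>\<close>.\<close>

theorem theorem4:
  fixes C :: "'c set" and F :: "'f set" and c :: "'f \<Rightarrow> 'c \<Rightarrow> real" and f :: "'f \<Rightarrow> real"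
    and \<gamma> :: real and xs :: "'f \<Rightarrow> 'c \<Rightarrow> real" and ys :: "'f \<Rightarrow> real"
    and S :: "'s set" and orig :: "'s \<Rightarrow> 'f" and ybar :: "'s \<Rightarrow> real"
    and xbar :: "'s \<Rightarrow> 'c \<Rightarrow> real" and centres :: "'c list"
  assumes inst: "squared_metric_instance C F c f"
    and gamma: "1 \<le> \<gamma>"
    and opt: "lp_optimal C F c f xs ys"
    and split: "cs_scaled_split C F c \<gamma> xs ys S orig ybar xbar"
    and clust: "greedy_clustering
                  (\<lambda>j. d_c c S orig ybar xbar j + d_max c S orig xbar j)
                  (Cset S xbar) C centres"
  shows "(\<forall>i\<in>F. measure_pmf.expectation (cs_rounding S ybar xbar centres)
                 (\<lambda>Op. real (card {s\<in>Op. orig s = i}) * f i) = \<gamma> * (ys i * f i))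
       \<and> (1 < \<gamma> \<longrightarrow> (\<forall>j\<in>C. measure_pmf.expectation (cs_rounding S ybar xbar centres)
                 (\<lambda>Op. Min ((\<lambda>s. c (orig s) j) ` Op))
              \<le> max (1 + 8 * exp (-\<gamma>)) ((5 * exp (-\<gamma>) + exp (-1)) / (1 - 1 / \<gamma>))
                  * (\<Sum>i\<in>F. xs i j * c i j)))"
proof (intro conjI ballI impI)
  have centres_C: "set centres \<subseteq> C" by (rule greedy_clustering_subset[OF clust])
  have finS: "finite S" and ybar: "\<And>s. s \<in> S \<Longrightarrow> 0 < ybar s \<and> ybar s \<le> 1"
    and copies: "\<And>i. i \<in> F \<Longrightarrow> (\<Sum>s\<in>{s\<in>S. orig s = i}. ybar s) = \<gamma> * ys i"
    and xbar01: "\<And>s j. s \<in> S \<Longrightarrow> j \<in> C \<Longrightarrow> xbar s j = 0 \<or> xbar s j = ybar s"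
    and xbar_sum_1: "\<And>j. j \<in> C \<Longrightarrow> (\<Sum>s\<in>S. xbar s j) = 1"
    using split unfolding cs_scaled_split_def by blast+
  interpret cluster_rounding S ybar xbar centres
  proof
    show "Cset S xbar k \<inter> Cset S xbar k' = {}"
      if "k \<in> set centres" "k' \<in> set centres" "k \<noteq> k'" for k k'
      using greedy_clustering_disjoint[OF clust that] .
    show "xbar s k = 0 \<or> xbar s k = ybar s" if "k \<in> set centres" "s \<in> S" for k s
      using that xbar01 centres_C by blast
  qed (use finS ybar xbar_sum_1 centres_C in \<open>auto intro: less_imp_le\<close>)
  {
    fix i assume i: "i \<in> F"
    have "{s\<in>Op. orig s = i} = Op \<inter> {s\<in>S. orig s = i}"
      if "Op \<in> set_pmf (cs_rounding S ybar xbar centres)" for Op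
      using cs_rounding_subset[OF that] by auto
    then have "measure_pmf.expectation (cs_rounding S ybar xbar centres)
                 (\<lambda>Op. real (card {s\<in>Op. orig s = i}) * f i)
        = measure_pmf.expectation (cs_rounding S ybar xbar centres)
                 (\<lambda>Op. real (card (Op \<inter> {s\<in>S. orig s = i})) * f i)"
      by (intro integral_cong_AE) (auto simp: AE_measure_pmf_iff)
    also have "\<dots> = (\<Sum>s\<in>{s\<in>S. orig s = i}. ybar s) * f i"
      using expectation_card_cs_rounding[of "{s\<in>S. orig s = i}"] by simp
    also have "\<dots> = \<gamma> * (ys i * f i)"
      using copies[OF i] by simp
    finally show "measure_pmf.expectation (cs_rounding S ybar xbar centres)
                 (\<lambda>Op. real (card {s\<in>Op. orig s = i}) * f i) = \<gamma> * (ys i * f i)" .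
  }
  fix j assume "1 < \<gamma>" and j: "j \<in> C"
  have "Cset S xbar j \<noteq> {}"
  proof
    assume "Cset S xbar j = {}"
    then have "(\<Sum>s\<in>S. xbar s j) \<le> 0" by (intro sum_nonpos) (auto simp: Cset_def not_less)
    then show False using xbar_sum_1[OF j] by simp
  qed
  from greedy_clustering_covers[OF clust j this] obtain k where k: "k \<in> set centres"
    "d_c c S orig ybar xbar k + d_max c S orig xbar k
       \<le> d_c c S orig ybar xbar j + d_max c S orig xbar j"
    "Cset S xbar k \<inter> Cset S xbar j \<noteq> {}" .
  have "lp_feasible C F xs ys" using opt by (simp add: lp_optimal_def)
  then show "measure_pmf.expectation (cs_rounding S ybar xbar centres)
                 (\<lambda>Op. Min ((\<lambda>s. c (orig s) j) ` Op))
              \<le> max (1 + 8 * exp (-\<gamma>)) ((5 * exp (-\<gamma>) + exp (-1)) / (1 - 1 / \<gamma>))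
                  * (\<Sum>i\<in>F. xs i j * c i j)"
    using expected_connection_cost[OF cluster_rounding_axioms inst \<open>1 < \<gamma>\<close> _ split j _ k]
      k(1) centres_C by auto
qed

end
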